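(* Let $p\in[1,\infty)\cup\{\infty\}$, let $n\ge1$, $m\ge0$, $d=n+m$, and let $H\in\mathbb{Z}^{d\times n}$ be a matrix of rank $n$ in reduced Hermite normal form such that $H$ has no singular $n\times n$ submatrices. Let $\Delta=\Delta(H)$. If $n>\Delta(2\Delta+1)^2+\log_2\Delta$, then there is an algorithm with complexity $O(n\log n\cdot\log^2\Delta)$ that solves the shortest lattice vector problem $\min\{\|x\|_p : x\in\Lambda(H)\setminus\{0\}\}$.
   Context: For $H\in\mathbb{Z}^{d\times n}$, $\Lambda(H)=\{Ht : t\in\mathbb{Z}^n\}$ is the lattice spanned by the columns of $H$. For an integer matrix $A$, $\Delta_k(A)$ is the greatest absolute value of the determinants of all $k\times k$ submatrices of $A$, and $\Delta(A)=\Delta_{\mathrm{rank}(A)}(A)$. Reduced Hermite normal form: write $H_B$ for the $n\times n$ matrix of the first $n$ rows of $H$ and $H_N$ for the $m\times n$ matrix of its remaining rows. $H$ is in reduced Hermite normal form if $H_B$ is non-singular and lower triangular, $0\le H_{ij}<H_{ii}$ for all $1\le j<i\le n$, and there is $s\in\{0,\dots,n\}$ with $H_{ii}=1$ for $i\le s$ and $H_{ii}\ge 2$ for $s<i\le n$ (so the first $s$ rows of $H_B$ are those of the identity matrix). Complexity is bit complexity.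
   Formalization: In the running time O(n log n · log²Δ), log Δ is read as max(1, log₂ Δ), because for Δ = 1 (e.g. H the 10×10 identity) the literal bound would be 0, which no algorithm meets; for Δ ≥ 2 nothing changes. *)

theory Defs
  imports
    Complex_Main
    "HOL-Library.Extended_Real"
    "HOL-Library.Log_Nat"
    "Jordan_Normal_Form.Determinant"
    "Jordan_Normal_Form.DL_Submatrix"
    "Jordan_Normal_Form.DL_Rank"
begin

section \<open>Lattices, minors and reduced Hermite normal form\<close>

text \<open>Matrices are 0-indexed.\<close>

definition column_lattice :: "int mat \<Rightarrow> int vec set" where
  "column_lattice H = {H *\<^sub>v t | t. t \<in> carrier_vec (dim_col H)}"

definition int_rank :: "int mat \<Rightarrow> nat" where
  "int_rank A = vec_space.rank (dim_row A) (map_mat rat_of_int A)"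

definition Delta_minor :: "nat \<Rightarrow> int mat \<Rightarrow> int" where
  "Delta_minor k A = Max {\<bar>det (submatrix A I J)\<bar> | I J.
     I \<subseteq> {..<dim_row A} \<and> J \<subseteq> {..<dim_col A} \<and> card I = k \<and> card J = k}"

definition Delta :: "int mat \<Rightarrow> int" where
  "Delta A = Delta_minor (int_rank A) A"

definition no_singular_maximal_submatrix :: "nat \<Rightarrow> int mat \<Rightarrow> bool" where
  "no_singular_maximal_submatrix n H \<longleftrightarrow>
     (\<forall>I J. I \<subseteq> {..<dim_row H} \<and> J \<subseteq> {..<dim_col H} \<and> card I = n \<and> card J = n
        \<longrightarrow> det (submatrix H I J) \<noteq> 0)"

definition reduced_HNF :: "nat \<Rightarrow> nat \<Rightarrow> int mat \<Rightarrow> bool" where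
  "reduced_HNF n m H \<longleftrightarrow>
     H \<in> carrier_mat (n + m) n \<and>
     det (submatrix H {..<n} {..<n}) \<noteq> 0 \<and>
     (\<forall>i<n. \<forall>j<n. i < j \<longrightarrow> H $$ (i, j) = 0) \<and>
     (\<forall>i<n. \<forall>j<i. 0 \<le> H $$ (i, j) \<and> H $$ (i, j) < H $$ (i, i)) \<and>
     (\<exists>s\<le>n. (\<forall>i<s. H $$ (i, i) = 1) \<and> (\<forall>i. s \<le> i \<and> i < n \<longrightarrow> H $$ (i, i) \<ge> 2))"

text \<open>The index \<^term>\<open>p\<close> is meant to range over \<^prop>\<open>1 \<le> p\<close>, with \<^prop>\<open>p = \<infinity>\<close> allowed.\<close>

definition lp_norm :: "ereal \<Rightarrow> int vec \<Rightarrow> real" where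
  "lp_norm p x =
     (if p = \<infinity> then Max {\<bar>real_of_int (x $ i)\<bar> | i. i < dim_vec x}
      else (\<Sum>i<dim_vec x. \<bar>real_of_int (x $ i)\<bar> powr real_of_ereal p) powr (1 / real_of_ereal p))"

definition is_shortest_vector :: "ereal \<Rightarrow> int mat \<Rightarrow> int vec \<Rightarrow> bool" where
  "is_shortest_vector p H x \<longleftrightarrow>
     x \<in> column_lattice H - {0\<^sub>v (dim_row H)} \<and>
     (\<forall>y \<in> column_lattice H - {0\<^sub>v (dim_row H)}. lp_norm p x \<le> lp_norm p y)"

section \<open>Random access machine with logarithmic cost\<close>

text \<open>
  Bit complexity is measured on a random access machine under the logarithmic cost criterion.
  A program uses finitely many named registers and a memory with indirect addressing; both hold
  integers of unbounded size. Every step is charged for the binary length of all integers it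
  handles, addresses included, and a product is charged the schoolbook cost.
\<close>

datatype arith_op = Add | Sub | Mul

datatype com =
    Skip
  | Const nat int
  | Arith arith_op nat nat nat
  | Load nat nat
  | Store nat nat
  | Seq com com
  | Cond nat com com
  | Loop nat com

type_synonym state = "(nat \<Rightarrow> int) \<times> (nat \<Rightarrow> int)"

text \<open>Binary length of the absolute value plus one bit for the sign.\<close>

definition bits :: "int \<Rightarrow> nat" where
  "bits x = nat (bitlen \<bar>x\<bar>) + 1"

fun arith_val :: "arith_op \<Rightarrow> int \<Rightarrow> int \<Rightarrow> int" where
  "arith_val Add a b = a + b"
| "arith_val Sub a b = a - b"
| "arith_val Mul a b = a * b"

fun arith_cost :: "arith_op \<Rightarrow> int \<Rightarrow> int \<Rightarrow> nat" where
  "arith_cost Add a b = bits a + bits b"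
| "arith_cost Sub a b = bits a + bits b"
| "arith_cost Mul a b = bits a * bits b"

text \<open>
  \<open>exec c \<sigma> t \<tau>\<close>: started in \<open>\<sigma>\<close>, the program \<open>c\<close> halts in \<open>\<tau>\<close> at total cost \<open>t\<close>. Memory access
  through a negative address is stuck. \<open>Cond\<close> and \<open>Loop\<close> test whether a register is positive.
\<close>

inductive exec :: "com \<Rightarrow> state \<Rightarrow> nat \<Rightarrow> state \<Rightarrow> bool" where
  Skip: "exec Skip \<sigma> 1 \<sigma>"
| Const: "exec (Const x c) (R, M) (bits c) (R(x := c), M)"
| Arith: "exec (Arith f x y z) (R, M) (arith_cost f (R y) (R z))
            (R(x := arith_val f (R y) (R z)), M)"
| Load: "0 \<le> R a \<Longrightarrow>
    exec (Load x a) (R, M) (bits (R a) + bits (M (nat (R a)))) (R(x := M (nat (R a))), M)"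
| Store: "0 \<le> R a \<Longrightarrow>
    exec (Store a x) (R, M) (bits (R a) + bits (R x)) (R, M(nat (R a) := R x))"
| Seq: "exec c1 \<sigma> t1 \<sigma>' \<Longrightarrow> exec c2 \<sigma>' t2 \<sigma>'' \<Longrightarrow> exec (Seq c1 c2) \<sigma> (t1 + t2) \<sigma>''"
| CondTrue: "R x > 0 \<Longrightarrow> exec c1 (R, M) t \<sigma>' \<Longrightarrow> exec (Cond x c1 c2) (R, M) (bits (R x) + t) \<sigma>'"
| CondFalse: "R x \<le> 0 \<Longrightarrow> exec c2 (R, M) t \<sigma>' \<Longrightarrow> exec (Cond x c1 c2) (R, M) (bits (R x) + t) \<sigma>'"
| LoopFalse: "R x \<le> 0 \<Longrightarrow> exec (Loop x c) (R, M) (bits (R x)) (R, M)"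
| LoopTrue: "R x > 0 \<Longrightarrow> exec c (R, M) t1 \<sigma>' \<Longrightarrow> exec (Loop x c) \<sigma>' t2 \<sigma>'' \<Longrightarrow>
    exec (Loop x c) (R, M) (bits (R x) + t1 + t2) \<sigma>''"

lemma exec_deterministic:
  "exec c \<sigma> t \<tau> \<Longrightarrow> exec c \<sigma> t' \<tau>' \<Longrightarrow> t' = t \<and> \<tau>' = \<tau>"
proof (induction arbitrary: t' \<tau>' rule: exec.induct)
  case (Seq c1 \<sigma> t1 \<sigma>' c2 t2 \<sigma>'')
  from Seq.prems show ?case by (cases rule: exec.cases) (use Seq.IH in blast)+
next
  case (CondTrue R x c1 M t \<sigma>' c2)
  from CondTrue.prems CondTrue.hyps show ?case
    by (cases rule: exec.cases) (auto dest: CondTrue.IH)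
next
  case (CondFalse R x c2 M t \<sigma>' c1)
  from CondFalse.prems CondFalse.hyps show ?case
    by (cases rule: exec.cases) (auto dest: CondFalse.IH)
next
  case (LoopTrue R x c M t1 \<sigma>' t2 \<sigma>'')
  from LoopTrue.prems LoopTrue.hyps show ?case
    by (cases rule: exec.cases) (simp, metis LoopTrue.IH)
qed (auto elim: exec.cases)

text \<open>
  Input convention: \<open>n\<close> and \<open>m\<close> are in registers 0 and 1, the matrix is stored densely in row-major
  order from memory cell 0 on, and all other registers and cells are 0.
\<close>

definition matrix_input :: "nat \<Rightarrow> nat \<Rightarrow> int mat \<Rightarrow> state" where
  "matrix_input n m H =
     ((\<lambda>_. 0)(0 := int n, 1 := int m),
      (\<lambda>k. if k < (n + m) * n then H $$ (k div n, k mod n) else 0))"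

text \<open>
  Output convention: on halting, register 0 holds the address of the first of \<open>d\<close> consecutive
  memory cells that contain the output vector.
\<close>

definition outputs_vector :: "nat \<Rightarrow> state \<Rightarrow> int vec \<Rightarrow> bool" where
  "outputs_vector d \<sigma> x \<longleftrightarrow>
     0 \<le> fst \<sigma> 0 \<and> x = vec d (\<lambda>i. snd \<sigma> (nat (fst \<sigma> 0) + i))"

text \<open>
  The factor \<open>log \<Delta>\<close> of a running time bound, read as at least 1: at \<open>\<Delta> = 1\<close> the bound would
  otherwise be \<open>0\<close>, which no algorithm meets. For \<open>\<Delta> \<ge> 2\<close> it is the binary logarithm.
\<close>

definition log_Delta :: "int mat \<Rightarrow> real" where
  "log_Delta H = max 1 (log 2 (real_of_int (Delta H)))"

end

theory Submission
  imports Defs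
begin

text \<open>
  The first \<open>s\<close> rows of \<open>H\<close> are unit vectors, and \<open>2\<^bsup>n-s\<^esup> \<le> det H\<^sub>B \<le> \<Delta>\<close>. The lower part of a column
  \<open>j < s\<close> of \<open>H\<^sub>B\<close> takes at most \<open>det H\<^sub>B\<close> values by reducedness. Expressing a row of \<open>H\<^sub>N\<close> in the rows of
  \<open>H\<^sub>B\<close> by Cramer's rule has minors of \<open>H\<close> as numerators, which bounds the first \<open>s\<close> entries of the
  row by \<open>\<Delta>\<close>. As \<open>s > \<Delta> (2\<Delta> + 1)\<^sup>2\<close>, two rows in \<open>H\<^sub>N\<close> would leave two of the first \<open>s\<close> columns
  equal outside of their unit rows, and thus yield a singular submatrix; so \<open>m \<le> 1\<close>.

  By the same count two columns \<open>a, b < s\<close> agree below row \<open>s\<close>, and \<open>e\<^sub>a - e\<^sub>b\<close> is a lattice vector. It is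
  shortest for every \<open>p\<close> unless the lattice contains a unit vector, which forward substitution shows
  to be one of the first \<open>s\<close> columns, with zeros below row \<open>s\<close>. The program encodes the lower
  part of each column as a number of size \<open>O(n\<^sup>2)\<close> and uses it as an address into a table, so that both
  kinds of vectors are found in one pass that reads \<open>O(log \<Delta>)\<close> entries in each column.
\<close>

section \<open>Cost-bounded weakest preconditions\<close>

lemma bits_mono: "\<bar>x\<bar> \<le> \<bar>y\<bar> \<Longrightarrow> bits x \<le> bits y"
  unfolding bits_def unfolding bitlen_def by (simp add: floorlog_mono nat_mono)

lemma bits_pos: "0 < bits x"
  unfolding bits_def by simp

lemma bits_le_log:
  assumes "1 \<le> x"
  shows "real (bits x) \<le> log 2 (real_of_int x) + 2"
proof -
  have "bitlen x = \<lfloor>log 2 x\<rfloor> + 1" using assms by (simp add: bitlen_alt_def)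
  moreover have "0 \<le> log 2 (real_of_int x)" using assms by simp
  ultimately show ?thesis using assms unfolding bits_def by (simp; linarith)
qed

locale ram_bounds =
  fixes N D :: int
  assumes N_ge1: "1 \<le> N"
begin

text \<open>Bounds the cost of one instruction while all registers are at most \<open>N\<close> in absolute value, if every
  product has a left factor of absolute value at most \<open>D\<close>.\<close>

definition unit_cost :: nat where
  "unit_cost = bits N * (bits D + 2)"

text \<open>The register bound is part of the postcondition, so that it is available again when the
  next program starts.\<close>

definition runs :: "com \<Rightarrow> nat \<Rightarrow> (nat \<Rightarrow> int) \<Rightarrow> (nat \<Rightarrow> int)
    \<Rightarrow> ((nat \<Rightarrow> int) \<Rightarrow> (nat \<Rightarrow> int) \<Rightarrow> bool) \<Rightarrow> bool" where
  "runs c k R M Q \<longleftrightarrow> (\<exists>t R' M'. exec c (R, M) t (R', M') \<and> t \<le> k * unit_cost \<and>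
     (\<forall>r. \<bar>R' r\<bar> \<le> N) \<and> Q R' M')"

text \<open>\<open>Loop\<close> gets \<open>False\<close> because loops are handled by
  \<open>runs_Loop\<close> with an explicit invariant. Memory contents are bounded only where they
  are loaded, since only then do they enter a cost.\<close>

primrec wp :: "com \<Rightarrow> (nat \<Rightarrow> int) \<Rightarrow> (nat \<Rightarrow> int)
    \<Rightarrow> ((nat \<Rightarrow> int) \<Rightarrow> (nat \<Rightarrow> int) \<Rightarrow> bool) \<Rightarrow> bool" where
  "wp Skip R M Q = Q R M"
| "wp (Const x c) R M Q = (\<bar>c\<bar> \<le> N \<and> Q (R(x := c)) M)"
| "wp (Arith f x y z) R M Q = ((f = Mul \<longrightarrow> \<bar>R y\<bar> \<le> D) \<and> \<bar>arith_val f (R y) (R z)\<bar> \<le> N \<and>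
     Q (R(x := arith_val f (R y) (R z))) M)"
| "wp (Load x a) R M Q = (0 \<le> R a \<and> \<bar>M (nat (R a))\<bar> \<le> N \<and> Q (R(x := M (nat (R a)))) M)"
| "wp (Store a x) R M Q = (0 \<le> R a \<and> Q R (M(nat (R a) := R x)))"
| "wp (Seq c1 c2) R M Q = wp c1 R M (\<lambda>R M. wp c2 R M Q)"
| "wp (Cond x c1 c2) R M Q = (if 0 < R x then wp c1 R M Q else wp c2 R M Q)"
| "wp (Loop x c) R M Q = False"

text \<open>Like \<open>wp\<close>, meant for loop-free programs only.\<close>

primrec steps :: "com \<Rightarrow> nat" where
  "steps Skip = 1"
| "steps (Const x c) = 1"
| "steps (Arith f x y z) = 1"
| "steps (Load x a) = 1"
| "steps (Store a x) = 1"
| "steps (Seq c1 c2) = steps c1 + steps c2"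
| "steps (Cond x c1 c2) = 1 + max (steps c1) (steps c2)"
| "steps (Loop x c) = 0"

lemma bits_le_unit_cost: "2 * bits N \<le> unit_cost"
  unfolding unit_cost_def by simp

lemma bits_le: "\<bar>x\<bar> \<le> N \<Longrightarrow> bits x \<le> bits N"
  using N_ge1 by (intro bits_mono) simp

lemma runs_Seq:
  assumes "runs c1 k1 R M Qm"
    and "\<And>R M. (\<forall>r. \<bar>R r\<bar> \<le> N) \<Longrightarrow> Qm R M \<Longrightarrow> runs c2 k2 R M Q"
  shows "runs (Seq c1 c2) (k1 + k2) R M Q"
proof -
  obtain t R1 M1 where 1: "exec c1 (R, M) t (R1, M1)" "t \<le> k1 * unit_cost" "\<forall>r. \<bar>R1 r\<bar> \<le> N" "Qm R1 M1"
    using assms(1) unfolding runs_def by blast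
  obtain t' R2 M2 where 2: "exec c2 (R1, M1) t' (R2, M2)" "t' \<le> k2 * unit_cost"
      "\<forall>r. \<bar>R2 r\<bar> \<le> N" "Q R2 M2"
    using assms(2)[OF 1(3,4)] unfolding runs_def by blast
  have "t + t' \<le> (k1 + k2) * unit_cost" using 1(2) 2(2) by (simp add: add_mult_distrib)
  then show ?thesis unfolding runs_def using exec.Seq[OF 1(1) 2(1)] 2(3,4) by blast
qed

text \<open>One unit pays for two operand lengths, or for a product of the lengths
  \<open>bits D\<close> and \<open>bits N\<close>; a branch needs one more unit for its
  test.\<close>

lemma runs_wp:
  "(\<forall>r. \<bar>R r\<bar> \<le> N) \<Longrightarrow> wp c R M Q \<Longrightarrow> runs c (steps c) R M Q"
proof (induction c arbitrary: R M Q)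
  case Skip
  have "1 \<le> unit_cost" using bits_le_unit_cost bits_pos[of N] by linarith
  then show ?case using Skip exec.Skip[of "(R, M)"] unfolding runs_def by fastforce
next
  case (Const x c)
  then have "bits c \<le> unit_cost" using bits_le[of c] bits_le_unit_cost by simp
  then show ?case using Const exec.Const[of x c R M] unfolding runs_def
    by (intro exI[of _ "bits c"] exI[of _ "R(x := c)"] exI[of _ M]) auto
next
  case (Arith f x y z)
  have b: "bits (R y) \<le> bits N" "bits (R z) \<le> bits N" using Arith bits_le by auto
  have "arith_cost f (R y) (R z) \<le> unit_cost"
  proof (cases f)
    case Mul
    then have "bits (R y) \<le> bits D" using Arith by (intro bits_mono) auto
    then have "bits (R y) * bits (R z) \<le> bits D * bits N" using b by (intro mult_le_mono)
    then show ?thesis using Mul unfolding unit_cost_def by (simp add: algebra_simps)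
  qed (use b bits_le_unit_cost in auto)
  then show ?case using Arith exec.Arith[of f x y z R M] unfolding runs_def
    by (intro exI[of _ "arith_cost f (R y) (R z)"] exI[of _ "R(x := arith_val f (R y) (R z))"] exI[of _ M])
      auto
next
  case (Load x a)
  let ?t = "bits (R a) + bits (M (nat (R a)))"
  have "?t \<le> unit_cost" 
  proof -
    have "bits (R a) \<le> bits N" "bits (M (nat (R a))) \<le> bits N" using Load by (auto intro: bits_le)
    then show ?thesis using bits_le_unit_cost by linarith
  qed
  then show ?case using Load exec.Load[of R a x M] unfolding runs_def
    by (intro exI[of _ ?t] exI[of _ "R(x := M (nat (R a)))"] exI[of _ M]) auto
next
  case (Store a x)
  let ?t = "bits (R a) + bits (R x)"
  have "?t \<le> unit_cost" 
  proof -
    have "bits (R a) \<le> bits N" "bits (R x) \<le> bits N" using Store by (auto intro: bits_le)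
    then show ?thesis using bits_le_unit_cost by linarith
  qed
  then show ?case using Store exec.Store[of R a x M] unfolding runs_def
    by (intro exI[of _ ?t] exI[of _ R] exI[of _ "M(nat (R a) := R x)"]) auto
next
  case (Seq c1 c2)
  show ?case unfolding steps.simps
    by (rule runs_Seq[where Qm = "\<lambda>R M. wp c2 R M Q"]) (use Seq in auto)
next
  case (Cond x c1 c2)
  have b: "bits (R x) \<le> unit_cost" using Cond bits_le[of "R x"] bits_le_unit_cost by simp
  show ?case
  proof (cases "0 < R x")
    case True
    then obtain t R' M' where "exec c1 (R, M) t (R', M')" "t \<le> steps c1 * unit_cost"
        "\<forall>r. \<bar>R' r\<bar> \<le> N" "Q R' M'"
      using Cond.IH(1)[of R M Q] Cond.prems unfolding runs_def by auto
    moreover from this(2) have "t \<le> max (steps c1) (steps c2) * unit_cost"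
      by (meson le_trans max.cobounded1 mult_le_mono1)
    ultimately have "bits (R x) + t \<le> steps (Cond x c1 c2) * unit_cost" "\<forall>r. \<bar>R' r\<bar> \<le> N" "Q R' M'"
        "exec (Cond x c1 c2) (R, M) (bits (R x) + t) (R', M')"
      using b exec.CondTrue[of R x c1 M t _ c2] True by simp_all
    then show ?thesis unfolding runs_def by blast
  next
    case False
    then obtain t R' M' where "exec c2 (R, M) t (R', M')" "t \<le> steps c2 * unit_cost"
        "\<forall>r. \<bar>R' r\<bar> \<le> N" "Q R' M'"
      using Cond.IH(2)[of R M Q] Cond.prems unfolding runs_def by auto
    moreover from this(2) have "t \<le> max (steps c1) (steps c2) * unit_cost"
      by (meson le_trans max.cobounded2 mult_le_mono1)
    ultimately have "bits (R x) + t \<le> steps (Cond x c1 c2) * unit_cost" "\<forall>r. \<bar>R' r\<bar> \<le> N" "Q R' M'"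
        "exec (Cond x c1 c2) (R, M) (bits (R x) + t) (R', M')"
      using b exec.CondFalse[of R x c2 M t _ c1] False by simp_all
    then show ?thesis unfolding runs_def by blast
  qed
qed simp

text \<open>The index of the invariant is the number of iterations left and thus also gives
  termination. Each iteration pays \<open>k\<close> units for the body and one for the test; the
  final unit is the failing test.\<close>

lemma runs_Loop:
  assumes step: "\<And>i R M. (\<forall>r. \<bar>R r\<bar> \<le> N) \<Longrightarrow> I (Suc i) R M \<Longrightarrow> 0 < R x \<and> runs c k R M (I i)"
    and stop: "\<And>R M. I 0 R M \<Longrightarrow> R x \<le> 0"
  shows "(\<forall>r. \<bar>R r\<bar> \<le> N) \<Longrightarrow> I i R M \<Longrightarrow> runs (Loop x c) (i * (k + 1) + 1) R M (I 0)"
proof (induction i arbitrary: R M)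
  case 0
  have "bits (R x) \<le> unit_cost" using 0 bits_le[of "R x"] bits_le_unit_cost by simp
  then show ?case using exec.LoopFalse[of R x c M] stop[OF 0(2)] 0 unfolding runs_def by fastforce
next
  case (Suc i)
  have b: "bits (R x) \<le> unit_cost" using Suc bits_le[of "R x"] bits_le_unit_cost by simp
  obtain t R1 M1 where 1: "0 < R x" "exec c (R, M) t (R1, M1)" "t \<le> k * unit_cost"
      "\<forall>r. \<bar>R1 r\<bar> \<le> N" "I i R1 M1"
    using step[OF Suc.prems] unfolding runs_def by blast
  obtain t' R2 M2 where 2: "exec (Loop x c) (R1, M1) t' (R2, M2)"
      "t' \<le> (i * (k + 1) + 1) * unit_cost" "\<forall>r. \<bar>R2 r\<bar> \<le> N" "I 0 R2 M2"
    using Suc.IH[OF 1(4,5)] unfolding runs_def by blast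
  have "bits (R x) + t + t' \<le> (Suc i * (k + 1) + 1) * unit_cost"
    using b 1(3) 2(2) by (simp add: algebra_simps)
  then show ?case using exec.LoopTrue[of R x c M, OF 1(1,2) 2(1)] 2(3,4) unfolding runs_def by blast
qed

end

section \<open>The program\<close>

fun seqs :: "com list \<Rightarrow> com" where
  "seqs [] = Skip"
| "seqs [c] = c"
| "seqs (c # cs) = Seq c (seqs cs)"

text \<open>
  Registers: 0 holds \<open>n\<close>, 1 holds \<open>m\<close>, 2 holds 1, 3 holds \<open>n\<^sup>2\<close>, 4 holds \<open>n + 1\<close>, 7 the address of the output
  block just behind the matrix, 8 the address of the look-up table behind it, 9 holds \<open>n - s\<close>, 13 holds 0,
  17 holds \<open>2 n\<close>. Register 5 first scans the diagonal upwards for the last entry 1 and then stays at the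
  first diagonal entry greater than 1. In the main loop 10 is the current column, 11 the address of
  its entry in row \<open>s\<close>, 12 and 14 run through the rows \<open>s, \<dots>, n - 1\<close> of this column and of the diagonal,
  15 counts the remaining rows and 16 accumulates the code of the column. Registers 18 and 19 hold a
  pair of distinct columns with equal codes, shifted by 1 so that 0 means that none is known.
\<close>

definition init_prog :: com where
  "init_prog = seqs
    [Const 2 1, Arith Add 4 0 2, Arith Add 17 0 0, Arith Mul 7 1 0, Arith Add 7 7 3,
     Arith Add 8 7 0, Arith Add 8 8 1, Arith Sub 5 3 2, Load 6 5, Arith Sub 6 6 2]"

definition scan_body :: com where
  "scan_body = seqs [Arith Add 9 9 2, Arith Sub 5 5 4, Load 6 5, Arith Sub 6 6 2]"

definition mid_prog :: com where
  "mid_prog = seqs [Arith Sub 10 0 9, Arith Add 5 5 4, Arith Add 11 5 13]"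

definition column_start :: com where
  "column_start = seqs
    [Arith Sub 10 10 2, Arith Sub 11 11 2, Arith Add 12 11 13, Arith Add 14 5 13,
     Arith Add 15 9 13, Const 16 0]"

definition digit_body :: com where
  "digit_body = seqs
    [Load 6 14, Arith Mul 16 16 6, Load 6 12, Arith Add 16 16 6,
     Arith Add 12 12 0, Arith Add 14 14 4, Arith Sub 15 15 2]"

text \<open>The cell addressed by the code of the column is read before it is overwritten: a
  positive entry there names a column treated earlier with the same code.\<close>

definition column_end :: com where
  "column_end = seqs
    [Arith Mul 16 16 17, Load 6 12, Arith Add 16 16 6, Arith Add 16 16 0, Arith Add 16 16 8,
     Load 6 16, Arith Add 20 10 2,
     Cond 6 (seqs [Arith Add 18 20 13, Arith Add 19 6 13]) Skip,
     Store 16 20]"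

text \<open>A column with zeros from row \<open>s\<close> on has code \<open>n\<close>, so the table
  entry at offset \<open>n\<close> tells whether a unit vector was found.\<close>

definition final_prog :: com where
  "final_prog = seqs
    [Arith Add 16 8 0, Load 6 16,
     Cond 6
       (seqs [Arith Add 20 7 6, Arith Sub 20 20 2, Store 20 2])
       (seqs [Arith Add 20 7 18, Arith Sub 20 20 2, Store 20 2,
              Arith Add 20 7 19, Arith Sub 20 20 2, Arith Sub 6 13 2, Store 20 6]),
     Arith Add 0 7 13]"

text \<open>The square of \<open>n\<close> is computed outside \<open>init_prog\<close>: its left
  factor violates the bound \<open>D\<close> that \<open>wp\<close> puts on left factors, so its
  cost is accounted for separately.\<close>

definition svp_prog :: com where
  "svp_prog = Seq (Arith Mul 3 0 0) (Seq init_prog (Seq (Loop 6 scan_body) (Seq mid_prog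
     (Seq (Loop 10 (Seq column_start (Seq (Loop 15 digit_body) column_end))) final_prog))))"

text \<open>The cells \<open>M0\<close> hold the matrix; for \<open>m = 0\<close> the \<open>n\<close> cells after it are 0 and play the role
  of a last row.\<close>

locale search_instance =
  fixes n m s :: nat and M0 :: "nat \<Rightarrow> int" and D :: int
  assumes m_le1: "m \<le> 1"
    and s_le: "s \<le> n"
    and diag_unit: "\<And>i. i < s \<Longrightarrow> M0 (i * n + i) = 1"
    and diag_ge2: "\<And>i. s \<le> i \<Longrightarrow> i < n \<Longrightarrow> 2 \<le> M0 (i * n + i)"
    and digit: "\<And>i j. s \<le> i \<Longrightarrow> i < n \<Longrightarrow> j < s \<Longrightarrow>
      0 \<le> M0 (i * n + j) \<and> M0 (i * n + j) < M0 (i * n + i)"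
    and prod_diag: "(\<Prod>i=s..<n. M0 (i * n + i)) \<le> D"
    and last_row: "\<And>j. j < s \<Longrightarrow> \<bar>M0 (n * n + j)\<bar> \<le> D"
    and zero_cells: "\<And>k. (n + m) * n \<le> k \<Longrightarrow> M0 k = 0"
    and many_columns: "D * (2 * D + 1)^2 < int s"
begin

text \<open>Mixed-radix number with the digits \<open>H\<^sub>i\<^sub>j\<close> to the bases \<open>H\<^sub>i\<^sub>i\<close>; it stays below \<open>det H\<^sub>B\<close>.\<close>

fun digits_code :: "nat \<Rightarrow> nat \<Rightarrow> int" where
  "digits_code j 0 = 0"
| "digits_code j (Suc i) = (if i < s then 0 else digits_code j i * M0 (i * n + i) + M0 (i * n + j))"

text \<open>The entry of the last row has absolute value at most \<open>D < n\<close>; adding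
  \<open>n\<close> turns it into a digit to the base \<open>2 * n\<close>.\<close>

definition col_code :: "nat \<Rightarrow> int" where
  "col_code j = digits_code j n * (2 * int n) + M0 (n * n + j) + int n"

section \<open>Column codes: ranges, injectivity and pigeonhole\<close>

lemma digits_code_start [simp]: "digits_code j s = 0"
proof -
  have "i \<le> s \<Longrightarrow> digits_code j i = 0" for i by (cases i) auto
  then show ?thesis by simp
qed

lemma prefix_le:
  assumes "s \<le> i" "i \<le> n"
  shows "(\<Prod>k=s..<i. M0 (k * n + k)) \<le> D"
proof -
  have "(\<Prod>k=s..<i. M0 (k * n + k)) \<le> (\<Prod>k=s..<n. M0 (k * n + k))"
  proof (rule prod_mono2)
    fix b assume "b \<in> {s..<n} - {s..<i}"
    then show "1 \<le> M0 (b * n + b)" using diag_ge2[of b] by simp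
  next
    fix b assume "b \<in> {s..<i}"
    then show "0 \<le> M0 (b * n + b)" using diag_ge2[of b] assms by simp
  qed (use assms in auto)
  then show ?thesis using prod_diag by simp
qed

lemma D_ge1: "1 \<le> D"
  using prefix_le[of s] s_le by simp

lemma diag_bounds:
  assumes "i < n"
  shows "1 \<le> M0 (i * n + i)" and "M0 (i * n + i) \<le> D"
proof -
  show "1 \<le> M0 (i * n + i)" using diag_unit[of i] diag_ge2[of i] assms by (cases "i < s") auto
  show "M0 (i * n + i) \<le> D"
  proof (cases "i < s")
    case True
    then show ?thesis using diag_unit[of i] D_ge1 by simp
  next
    case False
    have "M0 (i * n + i) = (\<Prod>k\<in>{i}. M0 (k * n + k))" by simp
    also have "\<dots> \<le> (\<Prod>k=s..<n. M0 (k * n + k))"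
    proof (rule prod_mono2)
      fix b assume "b \<in> {s..<n} - {i}"
      then show "1 \<le> M0 (b * n + b)" using diag_ge2[of b] by simp
    qed (use assms False diag_ge2[of i] in auto)
    finally show ?thesis using prod_diag by simp
  qed
qed

text \<open>From \<open>x + 1 \<le> P\<close> and a digit below the base \<open>a\<close>, the next
  code is below \<open>(x + 1) * a\<close>, which is at most \<open>P * a\<close>.\<close>

lemma digits_code_bounds:
  assumes "j < s" "s \<le> i" "i \<le> n"
  shows "0 \<le> digits_code j i \<and> digits_code j i < (\<Prod>k=s..<i. M0 (k * n + k))"
  using assms(2,3)
proof (induction rule: dec_induct)
  case (step i)
  let ?x = "digits_code j i" and ?P = "\<Prod>k=s..<i. M0 (k * n + k)" and ?a = "M0 (i * n + i)"
  have IH: "0 \<le> ?x" "?x + 1 \<le> ?P" and d: "0 \<le> M0 (i * n + j)" "M0 (i * n + j) < ?a"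
    using step digit[of i j] assms(1) by auto
  have "(?x + 1) * ?a \<le> ?P * ?a" using IH d by (intro mult_right_mono) auto
  moreover have "(\<Prod>k=s..<Suc i. M0 (k * n + k)) = ?P * ?a" using step by simp
  moreover have "0 \<le> ?x * ?a" using IH d by simp
  ultimately show ?case using step d by (auto simp: algebra_simps)
qed auto

lemma columns_bound: "9 * D < int s"
proof -
  have "D * 9 \<le> D * (2 * D + 1)^2"
    using D_ge1 power_mono[of 3 "2 * D + 1" 2] by (intro mult_left_mono) auto
  then show ?thesis using many_columns by simp
qed

lemma n_ge10: "10 \<le> n" and D_lt_n: "9 * D < int n"
  using columns_bound D_ge1 s_le by auto

text \<open>Division by the diagonal entry separates the last digit from the code of the preceding
  rows.\<close>

lemma digits_code_inj:
  assumes "j < s" "j' < s" "s \<le> i" "i \<le> n" "digits_code j i = digits_code j' i"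
  shows "\<forall>k. s \<le> k \<and> k < i \<longrightarrow> M0 (k * n + j) = M0 (k * n + j')"
  using assms(3-5)
proof (induction rule: dec_induct)
  case (step i)
  let ?a = "M0 (i * n + i)"
  have d: "0 \<le> M0 (i * n + j)" "M0 (i * n + j) < ?a" "0 \<le> M0 (i * n + j')" "M0 (i * n + j') < ?a"
    using step digit[of i] assms by auto
  have e: "digits_code j i * ?a + M0 (i * n + j) = digits_code j' i * ?a + M0 (i * n + j')"
    using step by auto
  have "(digits_code j i * ?a + M0 (i * n + j)) div ?a = digits_code j i"
    "(digits_code j' i * ?a + M0 (i * n + j')) div ?a = digits_code j' i" using d by auto
  then have "digits_code j i = digits_code j' i" using e by simp
  moreover from this have "M0 (i * n + j) = M0 (i * n + j')" using e by simp
  ultimately show ?case using step by (auto simp: less_Suc_eq)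
qed auto

lemma col_code_split:
  assumes "j < s"
  shows "col_code j div (2 * int n) = digits_code j n"
    and "col_code j mod (2 * int n) = M0 (n * n + j) + int n"
proof -
  have "0 \<le> M0 (n * n + j) + int n" "M0 (n * n + j) + int n < 2 * int n"
    using last_row[OF assms] D_lt_n D_ge1 by auto
  then show "col_code j div (2 * int n) = digits_code j n"
    "col_code j mod (2 * int n) = M0 (n * n + j) + int n"
    unfolding col_code_def add.assoc by simp_all
qed

lemma col_code_eqD:
  assumes "j < s" "j' < s" "col_code j = col_code j'"
  shows "\<And>i. s \<le> i \<Longrightarrow> i < n \<Longrightarrow> M0 (i * n + j) = M0 (i * n + j')"
    and "M0 (n * n + j) = M0 (n * n + j')"
  using digits_code_inj[OF assms(1,2) s_le le_refl] col_code_split[OF assms(1)]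
    col_code_split[OF assms(2)] assms(3) by auto

lemma digits_code_zeroD:
  assumes "j < s" "s \<le> i" "i \<le> n" "digits_code j i = 0"
  shows "\<forall>k. s \<le> k \<and> k < i \<longrightarrow> M0 (k * n + j) = 0"
  using assms(2-4)
proof (induction rule: dec_induct)
  case (step i)
  have d: "0 \<le> M0 (i * n + j)" "M0 (i * n + j) < M0 (i * n + i)"
    using step digit[of i] assms by auto
  have "0 \<le> digits_code j i * M0 (i * n + i)"
    using digits_code_bounds[OF assms(1), of i] step d by simp
  moreover have "digits_code j i * M0 (i * n + i) + M0 (i * n + j) = 0" using step by simp
  ultimately have "digits_code j i * M0 (i * n + i) = 0" "M0 (i * n + j) = 0" using d by linarith+
  then show ?case using step d by (auto simp: less_Suc_eq)
qed auto

lemma digits_code_zero: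
  assumes "\<And>k. s \<le> k \<Longrightarrow> k < n \<Longrightarrow> M0 (k * n + j) = 0" "i \<le> n"
  shows "digits_code j i = 0"
  using assms(2) by (induction i) (use assms(1) in auto)

lemma col_code_zero_iff:
  assumes "j < s"
  shows "col_code j = int n \<longleftrightarrow>
    (\<forall>i. s \<le> i \<and> i < n \<longrightarrow> M0 (i * n + j) = 0) \<and> M0 (n * n + j) = 0"
proof
  assume *: "col_code j = int n"
  then have "digits_code j n = 0" "M0 (n * n + j) = 0"
    using col_code_split[OF assms] n_ge10 by auto
  then show "(\<forall>i. s \<le> i \<and> i < n \<longrightarrow> M0 (i * n + j) = 0) \<and> M0 (n * n + j) = 0"
    using digits_code_zeroD[OF assms s_le le_refl] by simp
qed (simp add: col_code_def digits_code_zero)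

text \<open>Since \<open>2 * D \<le> n\<close>, the table offsets are at most \<open>n * n\<close>,
  which keeps all addresses quadratic in \<open>n\<close>.\<close>

lemma col_code_range:
  assumes "j < s"
  shows "0 \<le> col_code j" and "col_code j \<le> D * (2 * int n)"
proof -
  have *: "0 \<le> digits_code j n" "digits_code j n + 1 \<le> D"
    using digits_code_bounds[OF assms s_le] prefix_le[OF s_le] by auto
  have "\<bar>M0 (n * n + j)\<bar> \<le> int n" using last_row[OF assms] D_lt_n D_ge1 by auto
  moreover have "(digits_code j n + 1) * (2 * int n) \<le> D * (2 * int n)"
    using * by (intro mult_right_mono) auto
  moreover have "0 \<le> digits_code j n * (2 * int n)" using * by simp
  ultimately show "0 \<le> col_code j" "col_code j \<le> D * (2 * int n)"
    unfolding col_code_def by (auto simp: algebra_simps)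
qed

text \<open>The code depends only on a number in \<open>{0..<D}\<close> and an entry in
  \<open>{-D..D}\<close>, which leaves at most \<open>D * (2 * D + 1)\<close> codes for
  \<open>s\<close> columns.\<close>

lemma col_code_not_inj: "\<not> inj_on col_code {..<s}"
proof
  assume inj: "inj_on col_code {..<s}"
  let ?f = "\<lambda>(a, b). a * (2 * int n) + b + int n"
  have "col_code ` {..<s} \<subseteq> ?f ` ({0..<D} \<times> {-D..D})"
  proof
    fix x assume "x \<in> col_code ` {..<s}"
    then obtain j where j: "j < s" "x = col_code j" by auto
    then have "x = ?f (digits_code j n, M0 (n * n + j))" by (simp add: col_code_def)
    moreover have "digits_code j n \<in> {0..<D}" "M0 (n * n + j) \<in> {-D..D}"
      using digits_code_bounds[OF j(1) s_le] prefix_le[OF s_le] last_row[OF j(1)] by auto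
    ultimately show "x \<in> ?f ` ({0..<D} \<times> {-D..D})" by blast
  qed
  then have "card (col_code ` {..<s}) \<le> card ({0..<D} \<times> {-D..D})"
    by (meson card_image_le card_mono finite_SigmaI finite_atLeastAtMost_int
        finite_atLeastLessThan_int finite_imageI le_trans)
  then have "s \<le> nat D * nat (2 * D + 1)" using inj by (simp add: card_image card_cartesian_product algebra_simps)
  then have "int s \<le> D * (2 * D + 1)" using D_ge1 by (metis int_nat_eq nat_mult_distrib zle_int le_add_same_cancel1 nat_int_comparison(3) int_ops(7) nat_0_le mult_nonneg_nonneg order_trans zero_le_one add_nonneg_nonneg zero_le_numeral zero_le_mult_iff)
  also have "\<dots> \<le> D * (2 * D + 1)^2" using D_ge1 self_le_power[of "2 * D + 1" 2] by (intro mult_left_mono) auto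
  finally show False using many_columns by simp
qed


section \<open>Memory layout and loop invariants\<close>

definition out :: nat where "out = (n + m) * n"

definition tbl :: nat where "tbl = out + (n + m)"

definition fixed_regs :: "(nat \<Rightarrow> int) \<Rightarrow> bool" where
  "fixed_regs R \<longleftrightarrow> R 0 = int n \<and> R 2 = 1 \<and> R 4 = int n + 1 \<and> R 7 = int out \<and> R 8 = int tbl \<and>
     R 13 = 0 \<and> R 17 = 2 * int n"

text \<open>\<open>r\<close> is the number of iterations left and \<open>s - 1 + r\<close> the row
  under inspection; the scan stops at row \<open>s - 1\<close>, the last one with diagonal entry
  1.\<close>

definition scan_inv :: "nat \<Rightarrow> (nat \<Rightarrow> int) \<Rightarrow> (nat \<Rightarrow> int) \<Rightarrow> bool" where
  "scan_inv r R M \<longleftrightarrow> M = M0 \<and> fixed_regs R \<and> r \<le> n - s \<and> R 5 = int ((s - 1 + r) * (n + 1)) \<and>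
     R 6 = M0 ((s - 1 + r) * (n + 1)) - 1 \<and> R 9 = int (n - s - r) \<and> R 18 = 0"

text \<open>The entry for a repeated code may be any of its columns, as a new column overwrites the
  old one. Preserving the cells below \<open>tbl\<close> also keeps the output block zero until the
  end.\<close>

definition table :: "nat \<Rightarrow> (nat \<Rightarrow> int) \<Rightarrow> bool" where
  "table c M \<longleftrightarrow> (\<forall>k<tbl. M k = M0 k) \<and>
     (\<forall>a. M (tbl + a) = 0 \<and> (\<forall>j\<in>{c..<s}. col_code j \<noteq> int a) \<or>
          (\<exists>j\<in>{c..<s}. col_code j = int a \<and> M (tbl + a) = int j + 1))"

text \<open>For \<open>c = 0\<close> the first alternative contradicts
  \<open>col_code_not_inj\<close>, so a pair is known when the main loop ends.\<close>

definition collision :: "nat \<Rightarrow> int \<Rightarrow> int \<Rightarrow> bool" where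
  "collision c x y \<longleftrightarrow> x = 0 \<and> inj_on col_code {c..<s} \<or>
     (\<exists>a<s. \<exists>b<s. a \<noteq> b \<and> col_code a = col_code b \<and> x = int a + 1 \<and> y = int b + 1)"

definition loop_regs :: "(nat \<Rightarrow> int) \<Rightarrow> bool" where
  "loop_regs R \<longleftrightarrow> fixed_regs R \<and> R 5 = int (s * (n + 1)) \<and> R 9 = int (n - s)"

definition column_inv :: "nat \<Rightarrow> (nat \<Rightarrow> int) \<Rightarrow> (nat \<Rightarrow> int) \<Rightarrow> bool" where
  "column_inv c R M \<longleftrightarrow> loop_regs R \<and> c \<le> s \<and> R 10 = int c \<and> R 11 = int (s * n + c) \<and>
     table c M \<and> collision c (R 18) (R 19)"

text \<open>\<open>r\<close> rows are left, so the next one is \<open>n - r\<close>; the memory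
  stays fixed at \<open>M'\<close>.\<close>

definition digit_inv :: "nat \<Rightarrow> (nat \<Rightarrow> int) \<Rightarrow> nat \<Rightarrow> (nat \<Rightarrow> int) \<Rightarrow> (nat \<Rightarrow> int) \<Rightarrow> bool" where
  "digit_inv j M' r R M \<longleftrightarrow> M = M' \<and> loop_regs R \<and> R 10 = int j \<and> R 11 = int (s * n + j) \<and>
     table (Suc j) M \<and> collision (Suc j) (R 18) (R 19) \<and>
     r \<le> n - s \<and> R 15 = int r \<and> R 14 = int ((n - r) * (n + 1)) \<and> R 12 = int ((n - r) * n + j) \<and>
     R 16 = digits_code j (n - r)"

text \<open>A bound on all registers: addresses are of order \<open>n * n\<close>, and a cubic bound
  leaves room for lower-order terms while its length is still logarithmic in
  \<open>n\<close>.\<close>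

definition cap :: int where "cap = int n ^ 3"

lemma cap_ge: "10 * (int n * int n) \<le> cap" "100 * int n \<le> cap" "1000 \<le> cap"
proof -
  have n: "10 \<le> int n" using n_ge10 by simp
  have 1: "10 * int n \<le> int n * int n" by (rule mult_right_mono[OF n]) simp
  have "10 * int n * int n \<le> int n * int n * int n" by (rule mult_right_mono[OF 1]) simp
  then show 2: "10 * (int n * int n) \<le> cap" by (simp add: cap_def power3_eq_cube)
  show 3: "100 * int n \<le> cap" using 1 2 by linarith
  show "1000 \<le> cap" using 3 n by linarith
qed

sublocale ram_bounds cap D
  by unfold_locales (use cap_ge in simp)

lemma address_le:
  assumes "i < n" "j \<le> n"
  shows "int (i * n + j) \<le> int n * int n"
proof -
  have "Suc i * n \<le> n * n" using assms by (intro mult_le_mono1) simp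
  then have "i * n + j \<le> n * n" using assms by simp
  then show ?thesis by (metis of_nat_le_iff of_nat_mult)
qed

text \<open>Row \<open>n\<close> is included even for \<open>m = 0\<close>, where its cells are the
  output block.\<close>

lemma cell_lt_tbl:
  assumes "i \<le> n" "j < n"
  shows "i * n + j < tbl"
  unfolding tbl_def out_def add_mult_distrib using mult_le_mono1[OF assms(1), of n] assms(2) by linarith

section \<open>Correctness of the program blocks\<close>

lemma digit_step:
  assumes "j < s" "digit_inv j M' (Suc r) R M"
  shows "0 < R 15 \<and> wp digit_body R M (digit_inv j M' r)"
proof -
  define i where "i = n - Suc r"
  define g where "g = i * (n + 1)"
  define q where "q = i * n + j"
  have inv: "M' = M" "loop_regs R" "R 10 = int j" "R 11 = int (s * n + j)" "table (Suc j) M"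
    "collision (Suc j) (R 18) (R 19)" "Suc r \<le> n - s" "R 15 = int (Suc r)" "R 14 = int g" "R 12 = int q"
    "R 16 = digits_code j i"
    using assms(2) unfolding digit_inv_def g_def q_def i_def by auto
  have i: "n - r = Suc i" "s \<le> i" "i < n" using inv(7) unfolding i_def by auto
  have regs: "R 0 = int n" "R 2 = 1" "R 4 = int n + 1" using inv(2) unfolding loop_regs_def fixed_regs_def by auto
  have le: "int g \<le> int n * int n" "int q \<le> int n * int n"
    using address_le[OF i(3), of i] address_le[OF i(3), of j] assms(1) s_le i unfolding g_def q_def by auto
  have "g < tbl" "q < tbl" using cell_lt_tbl[of i i] cell_lt_tbl[of i j] i assms(1) s_le
    unfolding g_def q_def by auto
  then have M: "M g = M0 (i * n + i)" "M q = M0 (i * n + j)"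
    using inv(5) unfolding table_def g_def q_def by (auto simp: add.commute)
  define p where "p = digits_code j i * M g"
  have next_code: "digits_code j (n - r) = p + M q" using i M unfolding p_def by simp
  have d: "0 \<le> M q" "M q < M g" using digit[OF i(2,3) assms(1)] M by auto
  have x: "0 \<le> digits_code j i" "digits_code j i \<le> D"
    using digits_code_bounds[OF assms(1) i(2)] prefix_le[OF i(2)] i(3) by auto
  \<comment> \<open>The old and the new code are both at most \<open>D\<close>, as the left factor
    of a product must be.\<close>
  have y: "p + M q \<le> D"
    using digits_code_bounds[OF assms(1), of "Suc i"] prefix_le[of "Suc i"] i next_code by auto
  have z: "0 \<le> p" using x d unfolding p_def by simp
  have "M g \<le> D" using diag_bounds(2)[OF i(3)] M by simp
  note * = this d x y z le cap_ge D_lt_n D_ge1 n_ge10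
  have "int ((n - r) * (n + 1)) = int g + (int n + 1)" "int ((n - r) * n + j) = int q + int n"
    unfolding g_def q_def i(1) by (simp_all add: algebra_simps)
  moreover have "int r \<le> int n" "r \<le> n - s" using inv(7) by auto
  ultimately have "wp digit_body R M (digit_inv j M' r)"
    unfolding digit_body_def using * inv(1-6,8-) regs next_code
    by (simp add: digit_inv_def loop_regs_def fixed_regs_def abs_le_iff p_def[symmetric]
        del: of_nat_mult of_nat_add of_nat_diff mult_Suc_right add_Suc_right One_nat_def)
  then show ?thesis using inv by simp
qed

lemma base_le: "int out \<le> int n * int n + int n" "int tbl \<le> int n * int n + 2 * int n + 1"
proof -
  have "int m * int n \<le> int n" using m_le1 mult_right_mono[of "int m" 1 "int n"] by simp
  then show "int out \<le> int n * int n + int n" "int tbl \<le> int n * int n + 2 * int n + 1"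
    using m_le1 unfolding tbl_def out_def by (simp_all add: algebra_simps)
qed

lemma s_pos: "0 < s"
  using columns_bound D_ge1 by simp

lemma scan_step:
  assumes "scan_inv (Suc r) R M"
  shows "0 < R 6 \<and> wp scan_body R M (scan_inv r)"
proof -
  define i where "i = s - 1 + r"
  define g where "g = i * (n + 1)"
  have inv: "M = M0" "fixed_regs R" "Suc r \<le> n - s" "R 5 = int (Suc i * (n + 1))"
    "R 6 = M0 (Suc i * (n + 1)) - 1" "R 9 = int (n - s - Suc r)" "R 18 = 0"
    using assms s_pos unfolding scan_inv_def i_def by simp_all
  have i: "s \<le> Suc i" "Suc i < n" using inv(3) s_pos unfolding i_def by auto
  have "M0 (Suc i * n + Suc i) \<ge> 2" using diag_ge2 i by blast
  then have pos: "0 < R 6" using inv(5) by (simp add: algebra_simps)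
  have R5: "R 5 = int g + (int n + 1)" using inv(4) unfolding g_def by (simp add: algebra_simps)
  have K: "int (n - s - Suc r) + 1 = int (n - s - r)" "int (n - s - r) \<le> int n" using inv(3) by auto
  have d: "1 \<le> M0 g" "M0 g \<le> D" using diag_bounds[of i] i unfolding g_def by (simp_all add: add.commute)
  have le: "int g \<le> int n * int n"
    using address_le[of i i] i unfolding g_def by auto
  have regs: "R 2 = 1" "R 4 = int n + 1" using inv(2) unfolding fixed_regs_def by auto
  have "wp scan_body R M (scan_inv r)"
    unfolding scan_body_def using inv(1-3,6,7) R5 K d le regs cap_ge D_lt_n D_ge1 n_ge10
    by (simp add: scan_inv_def fixed_regs_def abs_le_iff i_def[symmetric] g_def[symmetric]
        del: of_nat_mult of_nat_add of_nat_diff mult_Suc_right add_Suc_right One_nat_def)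
  then show ?thesis using pos by simp
qed

lemma init_correct:
  assumes "R = ((\<lambda>_. 0)(0 := int n, 1 := int m))(3 := int n * int n)"
  shows "wp init_prog R M0 (scan_inv (n - s))"
proof -
  \<comment> \<open>The address of the last diagonal entry, where the scan starts.\<close>
  define g where "g = (n - 1) * (n + 1)"
  have g: "int g = int n * int n - 1" unfolding g_def using n_ge10 by (simp add: of_nat_diff algebra_simps)
  have "g = (n - 1) * n + (n - 1)" unfolding g_def by simp
  then have d: "1 \<le> M0 g" "M0 g \<le> D" using diag_bounds[of "n - 1"] n_ge10 by simp_all
  define w where "w = int n * int n"
  define v where "v = int m * int n"
  have out: "v + w = int out" unfolding out_def v_def w_def by (simp add: algebra_simps)
  have tbl: "int out + int n + int m = int tbl" unfolding tbl_def by simp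
  have e: "s - 1 + (n - s) = n - 1" using s_pos s_le by simp
  have "0 \<le> v" "v \<le> int n" using m_le1 mult_right_mono[of "int m" 1 "int n"] unfolding v_def by simp_all
  moreover have "10 \<le> int n" "int n \<le> w" using n_ge10 unfolding w_def by simp_all
  moreover have "nat (w - 1) = g" using g unfolding w_def by simp
  ultimately show ?thesis
    unfolding init_prog_def assms
    using base_le[folded w_def] m_le1 g[folded w_def] d cap_ge[folded w_def] D_lt_n D_ge1
    by (simp add: out tbl w_def[symmetric] v_def[symmetric] scan_inv_def fixed_regs_def abs_le_iff e
        g_def[symmetric]
        del: of_nat_mult of_nat_add of_nat_diff mult_Suc_right add_Suc_right One_nat_def)
qed

lemma mid_correct:
  assumes "scan_inv 0 R M0"
  shows "wp mid_prog R M0 (column_inv s)"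
proof -
  define g where "g = (s - 1) * (n + 1)"
  have g: "int (s * (n + 1)) = int g + (int n + 1)" "int (s * n + s) = int g + (int n + 1)"
    unfolding g_def using s_pos by (cases s; simp add: algebra_simps)+
  have inv: "fixed_regs R" "R 5 = int g" "R 9 = int (n - s)" "R 18 = 0"
    using assms unfolding scan_inv_def g_def by simp_all
  have "g = (s - 1) * n + (s - 1)" unfolding g_def by simp
  then have le: "int g \<le> int n * int n" using address_le[of "s - 1" "s - 1"] s_pos s_le by simp
  have s: "int n - int (n - s) = int s" "int (n - s) \<le> int n" "int s \<le> int n" using s_le by auto
  \<comment> \<open>All cells behind the matrix are 0 at first, which is an empty table.\<close>
  have table: "table s M0" unfolding table_def tbl_def out_def using zero_cells by simp
  show ?thesis unfolding mid_prog_def using inv le s table cap_ge n_ge10 g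
    by (simp add: column_inv_def loop_regs_def fixed_regs_def collision_def abs_le_iff
        del: of_nat_mult of_nat_add of_nat_diff mult_Suc_right add_Suc_right One_nat_def)
qed

lemma column_start_correct:
  assumes "column_inv (Suc j) R M"
  shows "0 < R 10 \<and> wp column_start R M (digit_inv j M (n - s))"
proof -
  define g where "g = s * (n + 1)"
  define q where "q = s * n + j"
  have inv: "loop_regs R" "Suc j \<le> s" "R 10 = int j + 1" "R 11 = int q + 1"
    "table (Suc j) M" "collision (Suc j) (R 18) (R 19)"
    using assms unfolding column_inv_def q_def by auto
  have regs: "R 0 = int n" "R 2 = 1" "R 13 = 0" "R 5 = int g" "R 9 = int (n - s)"
    using inv(1) unfolding loop_regs_def fixed_regs_def g_def by auto
  have e: "n - (n - s) = s" using s_le by simp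
  have "s * (n + 1) = s * n + s" by simp
  then have le: "int g \<le> int n * int n + int n" "int q \<le> int n * int n + int n" "int (n - s) \<le> int n"
      "int j \<le> int n"
    using inv(2) s_le mult_le_mono1[OF s_le, of n] unfolding g_def q_def of_nat_mult[symmetric] of_nat_add[symmetric] of_nat_le_iff
    by linarith+
  have "wp column_start R M (digit_inv j M (n - s))"
    unfolding column_start_def using inv regs le cap_ge n_ge10
    by (simp add: digit_inv_def loop_regs_def fixed_regs_def abs_le_iff e q_def[symmetric] g_def[symmetric]
        del: of_nat_mult of_nat_add of_nat_diff mult_Suc_right add_Suc_right One_nat_def)
  then show ?thesis using inv(3) by simp
qed

lemma insert_Suc_interval: "j < s \<Longrightarrow> insert j {Suc j..<s} = {j..<s}"
  by auto

lemma table_step: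
  assumes "table (Suc j) M" "j < s" "col_code j = int a"
  shows "table j (M(tbl + a := int j + 1))"
  using assms unfolding table_def insert_Suc_interval[OF assms(2), symmetric]
  by (auto simp: all_conj_distrib)

text \<open>A positive entry names a column after \<open>j\<close>, hence one different from
  \<open>j\<close>.\<close>

lemma collision_hit:
  assumes "table (Suc j) M" "j < s" "col_code j = int a" "0 < M (tbl + a)"
  shows "collision j (int j + 1) (M (tbl + a))"
proof -
  obtain b where "b \<in> {Suc j..<s}" "col_code b = int a" "M (tbl + a) = int b + 1"
    using assms unfolding table_def by (metis less_irrefl)
  then show ?thesis unfolding collision_def using assms(2,3)
    by (intro disjI2 exI[of _ j] exI[of _ b] conjI) auto
qed

lemma collision_miss:
  assumes "table (Suc j) M" "j < s" "col_code j = int a" "M (tbl + a) \<le> 0" "collision (Suc j) x y"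
  shows "collision j x y"
proof -
  have "\<forall>b\<in>{Suc j..<s}. col_code b \<noteq> int a"
    using assms(1,4) unfolding table_def by (smt (verit) of_nat_0_le_iff)
  then show ?thesis using assms(2,3,5) unfolding collision_def
    by (auto simp flip: insert_Suc_interval[OF assms(2)])
qed

lemma column_end_correct:
  assumes "j < s" "digit_inv j M' 0 R M"
  shows "wp column_end R M (column_inv j)"
proof -
  \<comment> \<open>After the last digit, register 12 has moved on to row \<open>n\<close>, so the
    next load reads the extra row, or a padding zero for \<open>m = 0\<close>.\<close>
  define q where "q = n * n + j"
  define x where "x = digits_code j n"
  have inv: "loop_regs R" "R 10 = int j" "R 11 = int (s * n + j)" "table (Suc j) M"
    "collision (Suc j) (R 18) (R 19)" "R 12 = int q" "R 16 = x"
    using assms(2) unfolding digit_inv_def q_def x_def by auto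
  have regs: "R 0 = int n" "R 2 = 1" "R 13 = 0" "R 8 = int tbl" "R 17 = 2 * int n"
    using inv(1) unfolding loop_regs_def fixed_regs_def by auto
  obtain a where a: "col_code j = int a" using col_code_range(1)[OF assms(1)] nonneg_int_cases by blast
  have Mq: "M q = M0 (n * n + j)" using inv(4) cell_lt_tbl[of n j] assms(1) s_le
    unfolding table_def q_def by auto
  have sum: "x * (2 * int n) + M q + int n + int tbl = int (tbl + a)"
    using a Mq unfolding col_code_def x_def by simp
  have x: "0 \<le> x" "x \<le> D" using digits_code_bounds[OF assms(1) s_le] prefix_le[OF s_le]
    unfolding x_def by auto
  then have "x * (2 * int n) \<le> D * (2 * int n)" by (intro mult_right_mono) auto
  moreover have D: "D * (2 * int n) \<le> int n * int n"
    using mult_right_mono[of "2 * D" "int n" "int n"] D_lt_n D_ge1 by (simp add: algebra_simps)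
  ultimately have prod: "0 \<le> x * (2 * int n)" "x * (2 * int n) \<le> int n * int n" using x by auto
  have h: "\<bar>M q\<bar> \<le> int n" using last_row[OF assms(1)] Mq D_lt_n D_ge1 by simp
  have "int a \<le> int n * int n" using col_code_range(2)[OF assms(1)] D a by simp
  then have adr: "int (tbl + a) \<le> 2 * (int n * int n) + 2 * int n + 1" using base_le by simp
  have entry: "0 \<le> M (tbl + a)" "M (tbl + a) \<le> int n"
  proof -
    have "M (tbl + a) = 0 \<or> (\<exists>b\<in>{Suc j..<s}. M (tbl + a) = int b + 1)"
      using inv(4) unfolding table_def by blast
    then show "0 \<le> M (tbl + a)" "M (tbl + a) \<le> int n" using s_le by auto
  qed
  have q: "0 \<le> int q" "int q \<le> int n * int n + int n" "int j < int n" using assms(1) s_le unfolding q_def by simp_all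
  note t = table_step[OF inv(4) assms(1) a]
  have hit: "0 < M (tbl + a) \<Longrightarrow> collision j (int j + 1) (M (tbl + a))"
    by (rule collision_hit[OF inv(4) assms(1) a])
  have miss: "\<not> 0 < M (tbl + a) \<Longrightarrow> collision j (R 18) (R 19)"
    using collision_miss[OF inv(4) assms(1) a _ inv(5)] by simp
  show ?thesis
    unfolding column_end_def
    using inv(1-3,6,7) regs sum x prod h adr entry q t hit miss cap_ge n_ge10 D_lt_n D_ge1 base_le assms(1)
    by (simp add: column_inv_def loop_regs_def fixed_regs_def abs_le_iff
        del: of_nat_mult of_nat_add of_nat_diff mult_Suc_right add_Suc_right One_nat_def)
qed

text \<open>A unit vector takes precedence. The second alternative records that no such column
  exists, since the minimality of the difference depends on it.\<close>

definition result :: "(nat \<Rightarrow> int) \<Rightarrow> (nat \<Rightarrow> int) \<Rightarrow> bool" where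
  "result R M \<longleftrightarrow> R 0 = int out \<and>
     ((\<exists>k<s. col_code k = int n \<and> (\<forall>i<n + m. M (out + i) = (if i = k then 1 else 0))) \<or>
      (\<forall>k<s. col_code k \<noteq> int n) \<and> (\<exists>a<s. \<exists>b<s. a \<noteq> b \<and> col_code a = col_code b \<and>
        (\<forall>i<n + m. M (out + i) = (if i = a then 1 else if i = b then - 1 else 0))))"

lemma final_correct:
  assumes "column_inv 0 R M"
  shows "wp final_prog R M result"
proof -
  have inv: "fixed_regs R" "table 0 M" "collision 0 (R 18) (R 19)"
    using assms unfolding column_inv_def loop_regs_def by auto
  have regs: "R 0 = int n" "R 2 = 1" "R 13 = 0" "R 7 = int out" "R 8 = int tbl"
    using inv(1) unfolding fixed_regs_def by auto
  obtain a b where ab: "a < s" "b < s" "a \<noteq> b" "col_code a = col_code b" "R 18 = int a + 1" "R 19 = int b + 1"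
    using inv(3) col_code_not_inj unfolding collision_def atLeast0LessThan by auto
  have ab': "int a < int n" "int b < int n" using ab s_le by auto
  have zero: "M (out + i) = 0" if "i < n + m" for i
    using inv(2) zero_cells[of "out + i"] that unfolding table_def tbl_def out_def by simp
  have e: "int tbl + int n = int (tbl + n)" "\<And>k. int out + int k = int (out + k)" by simp_all
  note bounds = regs cap_ge n_ge10 base_le ab'
  consider (none) "M (tbl + n) = 0" "\<forall>k<s. col_code k \<noteq> int n"
    | (unit) k where "k < s" "col_code k = int n" "M (tbl + n) = int k + 1"
    using inv(2) unfolding table_def atLeast0LessThan by blast
  then show ?thesis
  proof cases
    case none
    define M' where "M' = M(out + a := 1, out + b := -1)"
    have "\<forall>i<n + m. M' (out + i) = (if i = a then 1 else if i = b then - 1 else 0)"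
      unfolding M'_def using zero ab(3) by auto
    then have "result R' M'" if "R' 0 = int out" for R'
      unfolding result_def using that none(2) ab by blast
    then show ?thesis unfolding final_prog_def using bounds none(1) ab(5,6)
      by (simp add: e M'_def abs_le_iff del: of_nat_add flip: add.assoc)
  next
    case unit
    have k: "int k < int n" using unit s_le by simp
    define M' where "M' = M(out + k := 1)"
    have "\<forall>i<n + m. M' (out + i) = (if i = k then 1 else 0)"
      unfolding M'_def using zero by auto
    then have "result R' M'" if "R' 0 = int out" for R'
      unfolding result_def using that unit by blast
    then show ?thesis unfolding final_prog_def using bounds unit(3) k
      by (simp add: e M'_def abs_le_iff del: of_nat_add flip: add.assoc)
  qed
qed

section \<open>Running time\<close>

lemma steps_blocks:
  "steps init_prog = 10" "steps scan_body = 4" "steps mid_prog = 3" "steps column_start = 6"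
  "steps digit_body = 7" "steps column_end = 11" "steps final_prog = 11"
  by (simp_all add: init_prog_def scan_body_def mid_prog_def column_start_def digit_body_def
      column_end_def final_prog_def)

lemma column_step:
  assumes "\<forall>r. \<bar>R r\<bar> \<le> cap" "column_inv (Suc j) R M"
  shows "0 < R 10 \<and> runs (Seq column_start (Seq (Loop 15 digit_body) column_end))
    (8 * (n - s) + 18) R M (column_inv j)"
proof -
  have j: "j < s" using assms(2) unfolding column_inv_def by simp
  have "runs column_start 6 R M (digit_inv j M (n - s))"
    using runs_wp[OF assms(1), of column_start] column_start_correct[OF assms(2)]
    by (simp add: steps_blocks)
  moreover have "runs (Loop 15 digit_body) ((n - s) * (7 + 1) + 1) R' M' (digit_inv j M 0)"
    if "\<forall>r. \<bar>R' r\<bar> \<le> cap" "digit_inv j M (n - s) R' M'" for R' M'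
  proof (rule runs_Loop[where I = "digit_inv j M", OF _ _ that])
    fix r R M'' assume *: "\<forall>r. \<bar>R r\<bar> \<le> cap" "digit_inv j M (Suc r) R M''"
    have "runs digit_body (steps digit_body) R M'' (digit_inv j M r)"
      using digit_step[OF j *(2)] by (intro runs_wp[OF *(1)]) simp
    then show "0 < R 15 \<and> runs digit_body 7 R M'' (digit_inv j M r)"
      using digit_step[OF j *(2)] by (simp add: steps_blocks)
  qed (simp add: digit_inv_def)
  moreover have "runs column_end 11 R' M' (column_inv j)"
    if "\<forall>r. \<bar>R' r\<bar> \<le> cap" "digit_inv j M 0 R' M'" for R' M'
    using runs_wp[OF that(1) column_end_correct[OF j that(2)]] by (simp add: steps_blocks)
  ultimately have "runs (Seq column_start (Seq (Loop 15 digit_body) column_end))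
    (6 + ((n - s) * (7 + 1) + 1 + 11)) R M (column_inv j)"
    by (intro runs_Seq)
  then show ?thesis using column_start_correct[OF assms(2)] by (simp add: algebra_simps)
qed

text \<open>The loops contribute \<open>5 * (n - s) + 1\<close> and
  \<open>s * (8 * (n - s) + 19) + 1\<close> units, the straight-line blocks 10, 3 and 11.\<close>

lemma svp_prog_correct:
  obtains t R M where "exec svp_prog ((\<lambda>_. 0)(0 := int n, 1 := int m), M0) t (R, M)" "result R M"
    "t \<le> bits (int n) * bits (int n) + (26 + 5 * (n - s) + s * (8 * (n - s) + 19)) * unit_cost"
proof -
  let ?start = "(\<lambda>_. 0)(0 := int n, 1 := int m)"
  let ?R = "?start(3 := int n * int n)"
  let ?body = "Seq column_start (Seq (Loop 15 digit_body) column_end)"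
  have small: "\<forall>r. \<bar>?R r\<bar> \<le> cap" using m_le1 cap_ge by simp
  have "runs init_prog 10 ?R M0 (scan_inv (n - s))"
    using runs_wp[OF small init_correct[OF refl]] by (simp add: steps_blocks)
  moreover have "runs (Loop 6 scan_body) ((n - s) * (4 + 1) + 1) R M (scan_inv 0)"
    if "\<forall>r. \<bar>R r\<bar> \<le> cap" "scan_inv (n - s) R M" for R M
  proof (rule runs_Loop[where I = scan_inv, OF _ _ that])
    fix r R M assume *: "\<forall>r. \<bar>R r\<bar> \<le> cap" "scan_inv (Suc r) R M"
    have "runs scan_body (steps scan_body) R M (scan_inv r)"
      using scan_step[OF *(2)] by (intro runs_wp[OF *(1)]) simp
    then show "0 < R 6 \<and> runs scan_body 4 R M (scan_inv r)"
      using scan_step[OF *(2)] by (simp add: steps_blocks)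
  next
    fix R M assume "scan_inv 0 R M"
    then have "R 6 = M0 ((s - 1) * n + (s - 1)) - 1" unfolding scan_inv_def by (simp add: add.commute)
    then show "R 6 \<le> 0" using diag_unit[of "s - 1"] s_pos by simp
  qed
  moreover have "runs mid_prog 3 R M (column_inv s)"
    if "\<forall>r. \<bar>R r\<bar> \<le> cap" "scan_inv 0 R M" for R M
  proof -
    have "M = M0" using that(2) unfolding scan_inv_def by simp
    then show ?thesis using runs_wp[OF that(1) mid_correct] that(2) by (simp add: steps_blocks)
  qed
  moreover have "runs (Loop 10 ?body) (s * (8 * (n - s) + 18 + 1) + 1) R M (column_inv 0)"
    if "\<forall>r. \<bar>R r\<bar> \<le> cap" "column_inv s R M" for R M
    by (rule runs_Loop[where I = column_inv, OF column_step _ that]) (simp_all add: column_inv_def)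
  moreover have "runs final_prog 11 R M result"
    if "\<forall>r. \<bar>R r\<bar> \<le> cap" "column_inv 0 R M" for R M
    using runs_wp[OF that(1) final_correct[OF that(2)]] by (simp add: steps_blocks)
  ultimately have "runs (Seq init_prog (Seq (Loop 6 scan_body) (Seq mid_prog (Seq (Loop 10 ?body) final_prog))))
     (10 + ((n - s) * (4 + 1) + 1 + (3 + (s * (8 * (n - s) + 18 + 1) + 1 + 11)))) ?R M0 result"
    by (intro runs_Seq)
  then obtain t R M where t: "exec (Seq init_prog (Seq (Loop 6 scan_body) (Seq mid_prog
        (Seq (Loop 10 ?body) final_prog)))) (?R, M0) t (R, M)"
      "t \<le> (10 + ((n - s) * (4 + 1) + 1 + (3 + (s * (8 * (n - s) + 18 + 1) + 1 + 11)))) * unit_cost"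
      "result R M"
    unfolding runs_def by blast
  have "exec (Arith Mul 3 0 0) (?start, M0) (bits (int n) * bits (int n)) (?R, M0)"
    using exec.Arith[of Mul 3 0 0 ?start M0] by (simp add: fun_upd_twist)
  from exec.Seq[OF this t(1)] have "exec svp_prog (?start, M0) (bits (int n) * bits (int n) + t) (R, M)"
    unfolding svp_prog_def .
  then show ?thesis using t(3)
  proof (rule that)
    have *: "10 + ((n - s) * (4 + 1) + 1 + (3 + (s * (8 * (n - s) + 18 + 1) + 1 + 11)))
        = 26 + 5 * (n - s) + s * (8 * (n - s) + 19)" by simp
    show "bits (int n) * bits (int n) + t
        \<le> bits (int n) * bits (int n) + (26 + 5 * (n - s) + s * (8 * (n - s) + 19)) * unit_cost"
      using t(2) unfolding * by simp
  qed
qed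

text \<open>As \<open>n - s\<close> is at most \<open>l\<close>, the program takes at most
  \<open>58 * (n * l)\<close> units, with \<open>58 = 26 + 5 + 27\<close>. A unit is at most
  \<open>20 * (g * l)\<close> for \<open>g = log 2 n\<close>, because \<open>cap\<close> has length
  at most \<open>4 * g\<close>. The initial squaring adds 4, and
  \<open>1164 = 58 * 20 + 4\<close>.\<close>

lemma cost_bound:
  assumes t: "t \<le> bits (int n) * bits (int n) + (26 + 5 * (n - s) + s * (8 * (n - s) + 19)) * unit_cost"
    and l: "1 \<le> l" "log 2 D \<le> l" "real (n - s) \<le> l"
  shows "real t \<le> 1164 * (real n * log 2 (real n) * l\<^sup>2)"
proof -
  define g where "g = log 2 (real n)"
  have n: "10 \<le> real n" using n_ge10 by simp
  then have g3: "3 \<le> g" unfolding g_def by (simp add: le_log_iff)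
  have "real n < 2 ^ n" by (rule of_nat_less_two_power)
  then have gn: "g \<le> real n" unfolding g_def using n
    by (simp add: log_le_iff powr_realpow)
  have "real (bits cap) \<le> log 2 cap + 2" using cap_ge by (intro bits_le_log) simp
  moreover have "log 2 cap = 3 * g" unfolding cap_def g_def using n by (simp add: log_nat_power)
  ultimately have c: "real (bits cap) \<le> 4 * g" using g3 by simp
  have d: "real (bits D) + 2 \<le> 5 * l" using bits_le_log[OF D_ge1] l by simp
  have "real (bits (int n)) \<le> 2 * g" using bits_le_log[of "int n"] n g3 unfolding g_def by simp
  then have "real (bits (int n)) * real (bits (int n)) \<le> (2 * g) * (2 * g)"
    using g3 by (intro mult_mono) auto
  also have "\<dots> \<le> 4 * (real n * g)" using gn g3 by simp
  also have "\<dots> \<le> 4 * (real n * g * l\<^sup>2)" using l g3 n by simp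
  finally have sq: "real (bits (int n)) * real (bits (int n)) \<le> 4 * (real n * g * l\<^sup>2)" .
  have "real unit_cost = real (bits cap) * (real (bits D) + 2)"
    unfolding unit_cost_def by (simp add: algebra_simps)
  also have "\<dots> \<le> (4 * g) * (5 * l)" using c d g3 by (intro mult_mono) auto
  finally have u: "real unit_cost \<le> 20 * (g * l)" by simp
  have nl: "1 * 1 \<le> real n * l" "1 * real (n - s) \<le> real n * l" using n l by (intro mult_mono; simp)+
  have "real s * (8 * real (n - s) + 19) \<le> real n * (27 * l)"
    using s_le l by (intro mult_mono) auto
  then have "26 + 5 * real (n - s) + real s * (8 * real (n - s) + 19) \<le> 58 * (real n * l)"
    using nl by simp
  then have "(26 + 5 * real (n - s) + real s * (8 * real (n - s) + 19)) * real unit_cost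
      \<le> (58 * (real n * l)) * (20 * (g * l))"
    using u n l by (intro mult_mono) auto
  also have "\<dots> = 1160 * (real n * g * l\<^sup>2)" by (simp add: power2_eq_square)
  finally have "real (bits (int n)) * real (bits (int n))
      + (26 + 5 * real (n - s) + real s * (8 * real (n - s) + 19)) * real unit_cost
      \<le> 1164 * (real n * g * l\<^sup>2)"
    using sq by linarith
  moreover have "real t \<le> real (bits (int n)) * real (bits (int n))
      + (26 + 5 * real (n - s) + real s * (8 * real (n - s) + 19)) * real unit_cost"
    using of_nat_mono[OF t, where 'a = real] by (simp del: of_nat_diff)
  ultimately show ?thesis unfolding g_def[symmetric] by linarith
qed

end

section \<open>Matrices in reduced Hermite normal form\<close>

text \<open>Exactly \<open>a\<close> elements of the image lie below \<open>f a\<close>, and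
  \<open>pick\<close> lists a set in increasing order.\<close>

lemma pick_eqI:
  assumes "strict_mono_on {..<k} f" "a < k"
  shows "pick (f ` {..<k}) a = f a"
proof -
  have "{x \<in> f ` {..<k}. x < f a} = f ` {..<a}"
    using assms by (auto simp: strict_mono_on_less image_iff)
  moreover have "inj_on f {..<a}"
    using strict_mono_on_imp_inj_on[OF assms(1)] assms(2) by (auto intro: inj_on_subset)
  ultimately have "card {x \<in> f ` {..<k}. x < f a} = a" by (simp add: card_image)
  then show ?thesis using pick_card_in_set[of "f a" "f ` {..<k}"] assms(2) by simp
qed

lemma pick_lessThan: "j < k \<Longrightarrow> pick {..<k} j = j"
  using pick_eqI[of k "\<lambda>i. i" j] by (simp add: strict_mono_on_def)

section \<open>Minors and cofactors\<close>

lemma rows_submatrix: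
  assumes "A \<in> carrier_mat d n" "I \<subseteq> {..<d}" "card I = k"
  shows "submatrix A I {..<n} = mat k n (\<lambda>(i, j). A $$ (pick I i, j))"
proof -
  have "{i. i < d \<and> i \<in> I} = I" "{j. j < n \<and> j \<in> {..<n}} = {..<n}" using assms(2) by auto
  then show ?thesis using assms(1,3) unfolding submatrix_def by (intro eq_matI) (auto simp: pick_lessThan)
qed

lemma det_submatrix_le_Delta:
  assumes "A \<in> carrier_mat d n" "int_rank A = n" "I \<subseteq> {..<d}" "card I = n"
  shows "\<bar>det (submatrix A I {..<n})\<bar> \<le> Delta A"
proof -
  let ?S = "{\<bar>det (submatrix A I J)\<bar> | I J.
     I \<subseteq> {..<dim_row A} \<and> J \<subseteq> {..<dim_col A} \<and> card I = n \<and> card J = n}"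
  have "?S \<subseteq> (\<lambda>(I, J). \<bar>det (submatrix A I J)\<bar>) ` (Pow {..<dim_row A} \<times> Pow {..<dim_col A})"
    by auto
  then have "finite ?S" by (rule finite_subset) simp
  moreover have "\<bar>det (submatrix A I {..<n})\<bar> \<in> ?S"
    by (intro CollectI exI[of _ I] exI[of _ "{..<n}"]) (use assms(1,3,4) in auto)
  ultimately show ?thesis unfolding Delta_def Delta_minor_def assms(2) by (rule Max_ge)
qed

text \<open>Expanding along the exchanged row, moved to the bottom, gives the cofactors of row \<open>i\<close>.\<close>

lemma abs_det_row_exchange:
  fixes A :: "int mat"
  assumes A: "A \<in> carrier_mat d n" and i: "i < n" and r: "n \<le> r" "r < d"
  shows "\<bar>det (submatrix A (insert r ({..<n} - {i})) {..<n})\<bar> =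
    \<bar>\<Sum>j<n. A $$ (r, j) * cofactor (mat n n (\<lambda>(i, j). A $$ (i, j))) i j\<bar>"
proof -
  let ?B = "mat n n (\<lambda>(i, j). A $$ (i, j))"
  \<comment> \<open>Increasing enumeration of the exchanged row set, with \<open>r\<close> in the
    last place \<open>n - 1\<close>.\<close>
  define f where "f a = (if a < i then a else if a < n - 1 then Suc a else r)" for a
  define I where "I = insert r ({..<n} - {i})"
  have mono: "strict_mono_on {..<n} f" unfolding strict_mono_on_def f_def using i r by auto
  have I: "I = f ` {..<n}"
  proof (intro equalityI subsetI)
    fix x assume "x \<in> I"
    then consider "x = r" | "x < i" | "i < x" "x < n" unfolding I_def by force
    then show "x \<in> f ` {..<n}"
    proof cases
      case 1
      then have "x = f (n - 1)" "n - 1 < n" using i by (auto simp: f_def)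
      then show ?thesis by blast
    next
      case 2
      then have "x = f x" "x < n" using i by (auto simp: f_def)
      then show ?thesis by blast
    next
      case 3
      then have "x = f (x - 1)" "x - 1 < n" by (auto simp: f_def)
      then show ?thesis by blast
    qed
  qed (use i r in \<open>auto simp: I_def f_def split: if_splits\<close>)
  have "card I = n" unfolding I using strict_mono_on_imp_inj_on[OF mono] by (simp add: card_image)
  moreover have "I \<subseteq> {..<d}" using r unfolding I_def by auto
  ultimately have S: "submatrix A I {..<n} = mat n n (\<lambda>(a, j). A $$ (f a, j))"
    unfolding rows_submatrix[OF A \<open>I \<subseteq> {..<d}\<close> \<open>card I = n\<close>]
    by (intro eq_matI) (auto simp: I pick_eqI[OF mono])
  define S where "S = mat n n (\<lambda>(a, j). A $$ (f a, j))"
  have del: "mat_delete S (n - 1) j = mat_delete ?B i j" if "j < n" for j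
    unfolding S_def mat_delete_def using i that by (intro eq_matI) (auto simp: f_def)
  \<comment> \<open>The sign does not depend on \<open>j\<close>, so it factors out of the expansion
    and disappears in the absolute value.\<close>
  have cof: "cofactor S (n - 1) j = (-1) ^ (n - 1 + i) * cofactor ?B i j" if "j < n" for j
  proof -
    have "(-1 :: int) ^ (n - 1 + j) = (-1) ^ (n - 1 + i) * (-1) ^ (i + j)"
      by (simp add: power_add)
    then show ?thesis unfolding cofactor_def del[OF that] by simp
  qed
  have "det S = (\<Sum>j<n. S $$ (n - 1, j) * cofactor S (n - 1) j)"
    by (rule laplace_expansion_row) (use i in \<open>auto simp: S_def\<close>)
  also have "\<dots> = (\<Sum>j<n. (-1) ^ (n - 1 + i) * (A $$ (r, j) * cofactor ?B i j))"
    using cof i by (intro sum.cong) (auto simp: S_def f_def)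
  also have "\<dots> = (-1) ^ (n - 1 + i) * (\<Sum>j<n. A $$ (r, j) * cofactor ?B i j)"
    by (simp add: sum_distrib_left)
  finally show ?thesis using S unfolding S_def I_def by (simp add: abs_mult power_abs)
qed

text \<open>This is the entry \<open>(k, j)\<close> of \<open>adj_mat B * B\<close>, which is the
  determinant times the identity.\<close>

lemma cofactor_sum:
  fixes B :: "int mat"
  assumes B: "B \<in> carrier_mat n n" and "k < n" "j < n"
  shows "(\<Sum>i<n. cofactor B i k * B $$ (i, j)) = (if k = j then det B else 0)"
proof -
  have "(adj_mat B * B) $$ (k, j) = (\<Sum>i<n. cofactor B i k * B $$ (i, j))"
    using assms by (auto simp: adj_mat_def scalar_prod_def lessThan_atLeast0 intro!: sum.cong)
  then show ?thesis using adj_mat(3)[OF B] assms by auto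
qed

text \<open>An inequality of Bernoulli type, used to compare column sums with \<open>det HB\<close>.
  The induction step is the nonnegativity of a product of two predecessors.\<close>

lemma sum_pred_less_prod:
  fixes a :: "'a \<Rightarrow> int"
  assumes "finite S" "\<And>i. i \<in> S \<Longrightarrow> 1 \<le> a i"
  shows "1 + (\<Sum>i\<in>S. a i - 1) \<le> (\<Prod>i\<in>S. a i)"
  using assms
proof (induction S rule: finite_induct)
  case (insert x S)
  have x: "1 \<le> a x" using insert.prems by simp
  have p: "1 \<le> (\<Prod>i\<in>S. a i)" using insert.prems by (intro prod_ge_1) auto
  have "0 \<le> ((\<Prod>i\<in>S. a i) - 1) * (a x - 1)" using p x by (intro mult_nonneg_nonneg) auto
  then show ?case using insert by (simp add: algebra_simps)
qed simp

section \<open>Diagonal, determinant and extra rows\<close>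

locale hnf_instance =
  fixes n m s :: nat and H :: "int mat"
  assumes H: "H \<in> carrier_mat (n + m) n"
    and rank: "int_rank H = n"
    and nonsing: "no_singular_maximal_submatrix n H"
    and upper_zero: "\<And>i j. i < n \<Longrightarrow> j < n \<Longrightarrow> i < j \<Longrightarrow> H $$ (i, j) = 0"
    and lower: "\<And>i j. i < n \<Longrightarrow> j < i \<Longrightarrow> 0 \<le> H $$ (i, j) \<and> H $$ (i, j) < H $$ (i, i)"
    and s_le: "s \<le> n"
    and diag1: "\<And>i. i < s \<Longrightarrow> H $$ (i, i) = 1"
    and diag2: "\<And>i. s \<le> i \<Longrightarrow> i < n \<Longrightarrow> 2 \<le> H $$ (i, i)"
    and large: "real n > real_of_int (Delta H * (2 * Delta H + 1)\<^sup>2) + log 2 (real_of_int (Delta H))"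
begin

abbreviation HB :: "int mat" where "HB \<equiv> mat n n (\<lambda>(i, j). H $$ (i, j))"

lemma diag_pos: "i < n \<Longrightarrow> 1 \<le> H $$ (i, i)"
  using diag1[of i] diag2[of i] by (cases "i < s") auto

lemma unit_row: "i < s \<Longrightarrow> j < n \<Longrightarrow> H $$ (i, j) = (if i = j then 1 else 0)"
  using upper_zero[of i j] lower[of i j] diag1[of i] s_le by (cases i j rule: linorder_cases) auto

lemma det_HB: "det HB = (\<Prod>i=s..<n. H $$ (i, i))"
proof -
  have "det HB = (\<Prod>i=0..<n. H $$ (i, i))"
    using det_lower_triangular[of n HB] upper_zero by (simp add: prod_list_diag_prod)
  also have "\<dots> = (\<Prod>i=s..<n. H $$ (i, i))"
    using s_le diag1 by (intro prod.mono_neutral_right) auto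
  finally show ?thesis .
qed

lemma HB_eq: "submatrix H {..<n} {..<n} = HB"
proof -
  have "submatrix H {..<n} {..<n} = mat n n (\<lambda>(i, j). H $$ (pick {..<n} i, j))"
    by (rule rows_submatrix[OF H]) auto
  also have "\<dots> = HB" by (intro eq_matI) (auto simp: pick_lessThan)
  finally show ?thesis .
qed

lemma det_HB_pos: "1 \<le> det HB"
  unfolding det_HB by (intro prod_ge_1) (use diag_pos in auto)

lemma det_HB_le: "det HB \<le> Delta H"
  using det_submatrix_le_Delta[OF H rank, of "{..<n}"] HB_eq by simp

lemma Delta_pos: "1 \<le> Delta H"
  using det_HB_pos det_HB_le by simp

lemma bottom_size: "real (n - s) \<le> log 2 (Delta H)"
proof -
  have "(\<Prod>i=s..<n. 2) \<le> (\<Prod>i=s..<n. H $$ (i, i))"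
    by (intro prod_mono) (use diag2 in auto)
  then have "(2::int) ^ (n - s) \<le> Delta H" using det_HB det_HB_le by simp
  then have "(2::real) ^ (n - s) \<le> real_of_int (Delta H)"
    by (metis of_int_le_iff of_int_numeral of_int_power)
  then show ?thesis using Delta_pos by (simp add: le_log_iff powr_realpow)
qed

text \<open>The logarithmic term in \<open>large\<close> absorbs the \<open>n - s\<close> rows of
  \<open>HB\<close> that are not unit rows.\<close>

lemma many_unit_rows: "Delta H * (2 * Delta H + 1)\<^sup>2 < int s"
proof -
  have "real_of_int (Delta H * (2 * Delta H + 1)\<^sup>2) < real n - real (n - s)"
    using large bottom_size by linarith
  then have "real_of_int (Delta H * (2 * Delta H + 1)\<^sup>2) < real_of_int (int s)" using s_le by simp
  then show ?thesis by (simp only: of_int_less_iff)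
qed

text \<open>The numbers \<open>y i\<close> are the coordinates of row \<open>r\<close> in the rows
  of \<open>HB\<close>, multiplied by \<open>det HB\<close>. Up to sign they are minors of
  \<open>H\<close>, so \<open>Delta H\<close> bounds them. A column \<open>j < s\<close> of
  \<open>HB\<close> has sum at most \<open>det HB\<close>, and this factor cancels.\<close>

lemma extra_row_bound:
  assumes r: "n \<le> r" "r < n + m" and j: "j < s"
  shows "\<bar>H $$ (r, j)\<bar> \<le> Delta H"
proof -
  define y where "y i = (\<Sum>k<n. H $$ (r, k) * cofactor HB i k)" for i
  have jn: "j < n" using j s_le by simp
  have y: "\<bar>y i\<bar> \<le> Delta H" if "i < n" for i
  proof -
    have "card (insert r ({..<n} - {i})) = n" using that r by (simp add: card_insert_if)
    moreover have "insert r ({..<n} - {i}) \<subseteq> {..<n + m}" using r by auto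
    ultimately show ?thesis
      using det_submatrix_le_Delta[OF H rank, of "insert r ({..<n} - {i})"]
        abs_det_row_exchange[OF H that r] unfolding y_def by simp
  qed
  have nonneg: "0 \<le> H $$ (i, j)" if "i < n" for i
    using that jn upper_zero[of i j] lower[of i j] diag_pos[of i] by (cases i j rule: linorder_cases) auto
  have "(\<Sum>i<n. y i * H $$ (i, j)) = (\<Sum>i<n. \<Sum>k<n. H $$ (r, k) * (cofactor HB i k * HB $$ (i, j)))"
    unfolding y_def sum_distrib_right using jn by (intro sum.cong) (auto simp: mult.assoc)
  also have "\<dots> = (\<Sum>k<n. H $$ (r, k) * (\<Sum>i<n. cofactor HB i k * HB $$ (i, j)))"
    by (subst sum.swap) (simp add: sum_distrib_left)
  also have "\<dots> = (\<Sum>k<n. H $$ (r, k) * (if k = j then det HB else 0))"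
    using cofactor_sum[of HB n _ j] jn by (intro sum.cong) auto
  also have "\<dots> = H $$ (r, j) * det HB" using jn by (simp add: if_distrib cong: if_cong)
  finally have "H $$ (r, j) * det HB = (\<Sum>i<n. y i * H $$ (i, j))" ..
  then have "\<bar>\<Sum>i<n. y i * H $$ (i, j)\<bar> = \<bar>H $$ (r, j)\<bar> * \<bar>det HB\<bar>" by (metis abs_mult)
  then have "\<bar>H $$ (r, j)\<bar> * det HB = \<bar>\<Sum>i<n. y i * H $$ (i, j)\<bar>" using det_HB_pos by linarith
  also have "\<dots> \<le> (\<Sum>i<n. \<bar>y i * H $$ (i, j)\<bar>)" by (rule sum_abs)
  also have "\<dots> \<le> (\<Sum>i<n. Delta H * H $$ (i, j))"
  proof (rule sum_mono)
    fix i assume "i \<in> {..<n}"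
    then have "\<bar>y i\<bar> * H $$ (i, j) \<le> Delta H * H $$ (i, j)" "0 \<le> H $$ (i, j)"
      using y nonneg by (auto intro: mult_right_mono)
    then show "\<bar>y i * H $$ (i, j)\<bar> \<le> Delta H * H $$ (i, j)" by (simp only: abs_mult abs_of_nonneg)
  qed
  also have "\<dots> = Delta H * (\<Sum>i<n. H $$ (i, j))" by (simp add: sum_distrib_left)
  also have "\<dots> \<le> Delta H * det HB"
  proof (rule mult_left_mono)
    \<comment> \<open>The column meets the unit rows in a single 1; its entries below them are at
      most the diagonal entries minus 1.\<close>
    have "{..<n} = {..<s} \<union> {s..<n}" "{..<s} \<inter> {s..<n} = {}" using s_le by auto
    then have "(\<Sum>i<n. H $$ (i, j)) = (\<Sum>i<s. H $$ (i, j)) + (\<Sum>i=s..<n. H $$ (i, j))"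
      by (simp add: sum.union_disjoint)
    also have "(\<Sum>i<s. H $$ (i, j)) = 1"
      using unit_row[OF _ jn] j by simp
    also have "(\<Sum>i=s..<n. H $$ (i, j)) \<le> (\<Sum>i=s..<n. H $$ (i, i) - 1)"
      using lower j by (intro sum_mono) fastforce
    also have "1 + \<dots> \<le> det HB"
      unfolding det_HB using diag_pos by (intro sum_pred_less_prod) auto
    finally show "(\<Sum>i<n. H $$ (i, j)) \<le> det HB" by simp
  qed (use Delta_pos in simp)
  finally show ?thesis using det_HB_pos by simp
qed

text \<open>With two extra rows, two columns would agree in all rows but two of the unit rows;
  exchanging these two rows for the extra ones gives a singular submatrix.\<close>

lemma at_most_one_extra_row: "m \<le> 1"
proof (rule ccontr)
  assume "\<not> m \<le> 1"
  then have m: "n + 1 < n + m" "n < n + m" by auto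
  let ?\<Delta> = "Delta H"
  \<comment> \<open>The part of column \<open>j\<close> outside the unit rows. There are at most
    \<open>det HB * (2 * Delta H + 1)\<^sup>2\<close> possible values, fewer than
    \<open>s\<close>.\<close>
  define sig where "sig j = (restrict (\<lambda>i. H $$ (i, j)) {s..<n}, H $$ (n, j), H $$ (n + 1, j))" for j
  let ?P = "\<Pi>\<^sub>E i\<in>{s..<n}. {0..<H $$ (i, i)}"
  let ?T = "?P \<times> {-?\<Delta>..?\<Delta>} \<times> {-?\<Delta>..?\<Delta>}"
  have "sig ` {..<s} \<subseteq> ?T"
  proof (intro image_subsetI)
    fix j assume "j \<in> {..<s}"
    then show "sig j \<in> ?T"
      using lower[of _ j] extra_row_bound[of n j] extra_row_bound[of "n + 1" j] m
      unfolding sig_def by (simp add: abs_le_iff PiE_iff)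
  qed
  moreover have "finite ?T" by (intro finite_SigmaI finite_PiE) auto
  ultimately have "card (sig ` {..<s}) \<le> card ?T" by (intro card_mono)
  also have "int (card ?T) = (\<Prod>i=s..<n. H $$ (i, i)) * (2 * ?\<Delta> + 1)\<^sup>2"
  proof -
    have "int (card ?P) = (\<Prod>i=s..<n. H $$ (i, i))"
      using diag_pos by (auto simp: card_PiE intro!: prod.cong) (meson order_trans zero_le_one)
    then show ?thesis using Delta_pos by (simp add: card_cartesian_product power2_eq_square)
  qed
  also have "\<dots> \<le> ?\<Delta> * (2 * ?\<Delta> + 1)\<^sup>2"
    using det_HB_le unfolding det_HB by (intro mult_right_mono) auto
  also have "\<dots> < int s" by (rule many_unit_rows)
  finally have "card (sig ` {..<s}) < card {..<s}" by simp
  then have "\<not> inj_on sig {..<s}" using pigeonhole by blast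
  then obtain a b where ab: "a < s" "b < s" "a \<noteq> b" "sig a = sig b" unfolding inj_on_def by auto
  \<comment> \<open>A unit row other than \<open>a\<close> and \<open>b\<close> has zeros in both
    columns; all other rows are recorded by \<open>sig\<close>.\<close>
  have eqr: "H $$ (i, a) = H $$ (i, b)" if "i \<noteq> a" "i \<noteq> b" "i < n + 2" for i
  proof -
    have "i < s \<or> s \<le> i \<and> i < n \<or> i = n \<or> i = n + 1" using that by linarith
    then consider "i < s" | "s \<le> i" "i < n" | "i = n" | "i = n + 1" by blast
    then show ?thesis
    proof cases
      case 1
      then show ?thesis using unit_row[of i a] unit_row[of i b] that ab s_le by simp
    next
      case 2
      then show ?thesis using ab(4) unfolding sig_def by (auto dest: fun_cong[of _ _ i])
    qed (use ab(4) in \<open>auto simp: sig_def\<close>)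
  qed
  define I where "I = insert (n + 1) (insert n ({..<n} - {a, b}))"
  have "card ({..<n} - {a, b}) = n - 2" using ab s_le by (subst card_Diff_subset) auto
  then have card: "card I = n" using ab s_le unfolding I_def by simp
  have sub: "I \<subseteq> {..<n + m}" using m unfolding I_def by auto
  let ?S = "submatrix H I {..<n}"
  have S: "?S = mat n n (\<lambda>(i, j). H $$ (pick I i, j))" by (rule rows_submatrix[OF H sub card])
  have "col ?S a = col ?S b"
  proof (rule eq_vecI)
    fix i assume "i < dim_vec (col ?S b)"
    then have i: "i < n" unfolding S by simp
    then have "pick I i \<in> I" using pick_in_set_le[of i I] card by simp
    then have "pick I i \<noteq> a \<and> pick I i \<noteq> b \<and> pick I i < n + 2"
      using ab s_le unfolding I_def by auto
    then show "col ?S a $ i = col ?S b $ i" unfolding S using eqr i ab s_le by auto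
  qed (simp add: S)
  then have "det ?S = 0"
    by (intro det_identical_columns[of _ n a b]) (use ab s_le in \<open>auto simp: S\<close>)
  moreover have "det ?S \<noteq> 0"
    using nonsing sub card H unfolding no_singular_maximal_submatrix_def by auto
  ultimately show False by simp
qed

section \<open>Lattice membership and unit vectors\<close>

lemma lattice_memE:
  assumes "x \<in> column_lattice H"
  obtains t where "dim_vec x = n + m" "\<And>i. i < n + m \<Longrightarrow> x $ i = (\<Sum>j<n. H $$ (i, j) * t j)"
proof -
  obtain t where t: "x = H *\<^sub>v t" "t \<in> carrier_vec n" using assms H unfolding column_lattice_def by auto
  show ?thesis
  proof (rule that[of "\<lambda>j. t $ j"])
    show "dim_vec x = n + m" using t H by simp
    fix i assume "i < n + m"
    then show "x $ i = (\<Sum>j<n. H $$ (i, j) * t $ j)"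
      using t H by (auto simp: scalar_prod_def lessThan_atLeast0 intro!: sum.cong)
  qed
qed

lemma lattice_memI:
  assumes "dim_vec x = n + m" "\<And>i. i < n + m \<Longrightarrow> x $ i = (\<Sum>j<n. H $$ (i, j) * t j)"
  shows "x \<in> column_lattice H"
proof -
  have "x = H *\<^sub>v vec n t"
    using assms H by (intro eq_vecI) (auto simp: scalar_prod_def lessThan_atLeast0 intro!: sum.cong)
  then show ?thesis using H unfolding column_lattice_def by auto
qed

text \<open>Forward substitution in \<open>H t = \<plusminus>e\<^sub>k\<close>: reducedness forces \<open>t = \<plusminus>e\<^sub>k\<close>.\<close>

lemma unit_vector_in_lattice:
  assumes x: "x \<in> column_lattice H" and k: "k < n + m" "\<bar>x $ k\<bar> = 1"
    and zero: "\<And>i. i < n + m \<Longrightarrow> i \<noteq> k \<Longrightarrow> x $ i = 0"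
  shows "k < s" and "\<And>i. i < n + m \<Longrightarrow> i \<noteq> k \<Longrightarrow> H $$ (i, k) = 0"
proof -
  obtain t where t: "\<And>i. i < n + m \<Longrightarrow> x $ i = (\<Sum>j<n. H $$ (i, j) * t j)"
    using lattice_memE[OF x] by blast
  have tri: "x $ i = (\<Sum>j<i. H $$ (i, j) * t j) + H $$ (i, i) * t i" if "i < n" for i
  proof -
    have "x $ i = (\<Sum>j<n. H $$ (i, j) * t j)" using t that by simp
    also have "\<dots> = (\<Sum>j\<in>{..<Suc i}. H $$ (i, j) * t j)"
      using upper_zero[of i] that by (intro sum.mono_neutral_right) auto
    finally show ?thesis by simp
  qed
  have only_k: "t i = 0" if "i < n" "i \<noteq> k" for i
    using that
  proof (induction i rule: less_induct)
    case (less i)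
    have 0: "0 = (\<Sum>j<i. H $$ (i, j) * t j) + H $$ (i, i) * t i" using tri less.prems zero[of i] by simp
    have IH: "\<And>j. j < i \<Longrightarrow> j \<noteq> k \<Longrightarrow> t j = 0" using less by simp
    show ?case
    proof (cases "k < i")
      case False
      then have "(\<Sum>j<i. H $$ (i, j) * t j) = 0" using IH by (intro sum.neutral) auto
      then show ?thesis using 0 diag_pos[of i] less.prems by simp
    next
      \<comment> \<open>Below row \<open>k\<close> the equation is
        \<open>H $$ (i, i) * t i = - (H $$ (i, k) * t k)\<close> with \<open>t k\<close> equal to 1
        or -1; a nonzero \<open>t i\<close> would make the left side too large.\<close>
      case True
      then have kn: "k < n" using less by simp
      have "(\<Sum>j<k. H $$ (k, j) * t j) = 0" using IH True by (intro sum.neutral) auto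
      then have "\<bar>H $$ (k, k) * t k\<bar> = 1" using tri[OF kn] k by simp
      then have tk: "\<bar>t k\<bar> = 1" by (metis abs_zmult_eq_1 mult.commute)
      have "(\<Sum>j<i. H $$ (i, j) * t j) = (\<Sum>j\<in>{k}. H $$ (i, j) * t j)"
        using IH True by (intro sum.mono_neutral_right) auto
      then have "H $$ (i, i) * t i = - (H $$ (i, k) * t k)" using 0 by simp
      then have "\<bar>H $$ (i, i)\<bar> * \<bar>t i\<bar> = \<bar>H $$ (i, k)\<bar> * \<bar>t k\<bar>"
        by (simp flip: abs_mult)
      then have "\<bar>H $$ (i, i)\<bar> * \<bar>t i\<bar> = \<bar>H $$ (i, k)\<bar>" using tk by simp
      moreover have "\<bar>H $$ (i, k)\<bar> < \<bar>H $$ (i, i)\<bar>" using lower[of i k] True less.prems by simp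
      moreover have "\<bar>H $$ (i, i)\<bar> * 1 \<le> \<bar>H $$ (i, i)\<bar> * \<bar>t i\<bar>" if "t i \<noteq> 0"
        using that by (intro mult_left_mono) auto
      ultimately show ?thesis by force
    qed
  qed
  have xi: "x $ i = (if k < n then H $$ (i, k) * t k else 0)" if "i < n + m" for i
  proof -
    have "x $ i = (\<Sum>j<n. if j = k then H $$ (i, j) * t j else 0)"
      unfolding t[OF that] using only_k by (intro sum.cong) auto
    then show ?thesis by simp
  qed
  \<comment> \<open>For \<open>k \<ge> n\<close> the whole vector would vanish. The diagonal entry
    in row \<open>k\<close> divides 1, so this row is a unit row.\<close>
  then have kn: "k < n" and "\<bar>H $$ (k, k) * t k\<bar> = 1" using k by (auto split: if_splits)
  then have tk: "\<bar>t k\<bar> = 1" "\<bar>H $$ (k, k)\<bar> = 1" by (metis abs_zmult_eq_1 mult.commute)+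
  then show "k < s" using diag2[of k] kn by force
  show "H $$ (i, k) = 0" if "i < n + m" "i \<noteq> k" for i
    using xi[OF that(1)] zero[OF that] kn tk by auto
qed

end

section \<open>Shortest vectors\<close>

text \<open>For entries in \<open>{-1, 0, 1}\<close> the sum of powers equals the l1 norm, while an
  integer is never larger in absolute value than its power. For the maximum norm, \<open>z\<close>
  has norm at most 1 and a nonzero integer vector at least 1.\<close>

lemma lp_norm_le_of_l1:
  assumes p: "1 \<le> p" and dims: "dim_vec z = d" "dim_vec x = d"
    and z: "\<And>i. i < d \<Longrightarrow> \<bar>z $ i\<bar> \<le> 1"
    and le: "(\<Sum>i<d. \<bar>z $ i\<bar>) \<le> (\<Sum>i<d. \<bar>x $ i\<bar>)"
    and x: "\<exists>i<d. x $ i \<noteq> 0"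
  shows "lp_norm p z \<le> lp_norm p x"
proof (cases "p = \<infinity>")
  case True
  let ?A = "\<lambda>v. {\<bar>real_of_int (v $ i)\<bar> | i. i < d}"
  obtain k where k: "k < d" "x $ k \<noteq> 0" using x by blast
  have fin: "finite (?A v)" for v :: "int vec" by simp
  have "a \<le> 1" if "a \<in> ?A z" for a using that z by (auto simp flip: of_int_abs)
  moreover have "?A z \<noteq> {}" using k by blast
  ultimately have "Max (?A z) \<le> 1" using fin[of z] by (subst Max_le_iff) auto
  also have "1 \<le> \<bar>real_of_int (x $ k)\<bar>" using k(2) by (simp flip: of_int_abs)
  also have "\<dots> \<le> Max (?A x)" using k(1) fin[of x] by (intro Max_ge) auto
  finally show ?thesis using True dims unfolding lp_norm_def by simp
next
  case False
  define q where "q = real_of_ereal p"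
  have q: "1 \<le> q" using p False unfolding q_def by (cases p) (auto simp: one_ereal_def)
  have "(\<Sum>i<d. \<bar>real_of_int (z $ i)\<bar> powr q) = (\<Sum>i<d. real_of_int \<bar>z $ i\<bar>)"
  proof (intro sum.cong refl)
    fix i assume "i \<in> {..<d}"
    then have "\<bar>z $ i\<bar> = 0 \<or> \<bar>z $ i\<bar> = 1" using z[of i] by force
    then show "\<bar>real_of_int (z $ i)\<bar> powr q = real_of_int \<bar>z $ i\<bar>"
      by (auto simp flip: of_int_abs)
  qed
  also have "\<dots> \<le> (\<Sum>i<d. real_of_int \<bar>x $ i\<bar>)" using le by (simp only: of_int_sum[symmetric] of_int_le_iff)
  also have "\<dots> \<le> (\<Sum>i<d. \<bar>real_of_int (x $ i)\<bar> powr q)"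
  proof (rule sum_mono)
    fix i
    show "real_of_int \<bar>x $ i\<bar> \<le> \<bar>real_of_int (x $ i)\<bar> powr q"
    proof (cases "x $ i = 0")
      case False
      then have "1 \<le> \<bar>real_of_int (x $ i)\<bar>" by (simp flip: of_int_abs)
      then have "\<bar>real_of_int (x $ i)\<bar> powr 1 \<le> \<bar>real_of_int (x $ i)\<bar> powr q"
        using q by (intro powr_mono) auto
      then show ?thesis by simp
    qed simp
  qed
  finally have "(\<Sum>i<d. \<bar>real_of_int (z $ i)\<bar> powr q) powr (1 / q) \<le> (\<Sum>i<d. \<bar>real_of_int (x $ i)\<bar> powr q) powr (1 / q)"
    using q by (intro powr_mono2) (auto intro: sum_nonneg)
  then show ?thesis using False dims unfolding lp_norm_def q_def by simp
qed

text \<open>Only vectors of the second kind can beat a difference of two unit vectors.\<close>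

lemma l1_norm_cases:
  fixes x :: "nat \<Rightarrow> int"
  assumes "\<exists>i<d. x i \<noteq> 0"
  obtains "2 \<le> (\<Sum>i<d. \<bar>x i\<bar>)"
    | k where "k < d" "\<bar>x k\<bar> = 1" "\<And>i. i < d \<Longrightarrow> i \<noteq> k \<Longrightarrow> x i = 0"
proof -
  obtain k where k: "k < d" "x k \<noteq> 0" using assms by blast
  have split: "(\<Sum>i<d. \<bar>x i\<bar>) = \<bar>x k\<bar> + (\<Sum>i\<in>{..<d} - {k}. \<bar>x i\<bar>)"
    using k by (subst sum.remove[of _ k]) auto
  have nonneg: "0 \<le> (\<Sum>i\<in>{..<d} - {k}. \<bar>x i\<bar>)" by (rule sum_nonneg) simp
  show thesis
  proof (cases "2 \<le> (\<Sum>i<d. \<bar>x i\<bar>)")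
    case False
    then have "\<bar>x k\<bar> = 1" "(\<Sum>i\<in>{..<d} - {k}. \<bar>x i\<bar>) = 0" using split nonneg k(2) by linarith+
    then show thesis using that(2)[of k] k(1) by (simp add: sum_nonneg_eq_0_iff)
  qed (use that in blast)
qed

context hnf_instance
begin

lemma is_shortestI:
  assumes p: "1 \<le> p" and z: "z \<in> column_lattice H" "\<And>i. i < n + m \<Longrightarrow> \<bar>z $ i\<bar> \<le> 1"
      "\<exists>i<n + m. z $ i \<noteq> 0"
    and le: "\<And>x. x \<in> column_lattice H \<Longrightarrow> \<exists>i<n + m. x $ i \<noteq> 0 \<Longrightarrow>
      (\<Sum>i<n + m. \<bar>z $ i\<bar>) \<le> (\<Sum>i<n + m. \<bar>x $ i\<bar>)"
  shows "is_shortest_vector p H z"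
proof -
  have dim: "dim_vec x = n + m" if "x \<in> column_lattice H" for x
    using lattice_memE[OF that] by blast
  have nz: "\<exists>i<n + m. x $ i \<noteq> 0" if "x \<in> column_lattice H - {0\<^sub>v (n + m)}" for x
  proof (rule ccontr)
    assume "\<not> (\<exists>i<n + m. x $ i \<noteq> 0)"
    then have "x = 0\<^sub>v (n + m)" using dim that by (intro eq_vecI) auto
    then show False using that by simp
  qed
  have "z \<noteq> 0\<^sub>v (n + m)" using z(3) by auto
  then show ?thesis using H z lp_norm_le_of_l1[OF p dim dim z(2) le] nz
    unfolding is_shortest_vector_def by auto
qed

lemma column_in_lattice:
  assumes "k < n" "dim_vec x = n + m" "\<And>i. i < n + m \<Longrightarrow> x $ i = H $$ (i, k)"
  shows "x \<in> column_lattice H"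
proof (rule lattice_memI[OF assms(2)])
  fix i assume "i < n + m"
  then show "x $ i = (\<Sum>j<n. H $$ (i, j) * (if j = k then 1 else 0))"
    using assms by (simp add: if_distrib cong: if_cong)
qed

lemma column_diff_in_lattice:
  assumes "a < n" "b < n" "dim_vec x = n + m"
    "\<And>i. i < n + m \<Longrightarrow> x $ i = H $$ (i, a) - H $$ (i, b)"
  shows "x \<in> column_lattice H"
proof (rule lattice_memI[OF assms(3)])
  fix i assume "i < n + m"
  moreover have "(\<Sum>j<n. H $$ (i, j) * ((if j = a then 1 else 0) - (if j = b then 1 else 0))) =
      (\<Sum>j<n. (if j = a then H $$ (i, a) else 0) - (if j = b then H $$ (i, b) else 0))"
    by (intro sum.cong) auto
  ultimately show "x $ i = (\<Sum>j<n. H $$ (i, j) * ((if j = a then 1 else 0) - (if j = b then 1 else 0)))"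
    using assms by (simp add: sum_subtractf)
qed

lemma unit_vector_shortest:
  assumes "1 \<le> p" "k < s" "\<And>i. s \<le> i \<Longrightarrow> i < n + m \<Longrightarrow> H $$ (i, k) = 0"
  shows "is_shortest_vector p H (vec (n + m) (\<lambda>i. if i = k then 1 else 0))" (is "is_shortest_vector p H ?z")
proof (rule is_shortestI[OF assms(1)])
  have k: "k < n" using assms(2) s_le by simp
  have "H $$ (i, k) = (if i = k then 1 else 0)" if "i < n + m" for i
    using that assms(2,3) unit_row[OF _ k, of i] by (cases "i < s") auto
  then show "?z \<in> column_lattice H" using k by (intro column_in_lattice[of k]) auto
  show "\<exists>i<n + m. ?z $ i \<noteq> 0" using k by (intro exI[of _ k]) simp
  fix x assume "\<exists>i<n + m. x $ i \<noteq> (0 :: int)"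
  then have "1 \<le> (\<Sum>i<n + m. \<bar>x $ i\<bar>)" by (cases rule: l1_norm_cases)
    (simp, metis (no_types, lifting) abs_ge_zero finite_lessThan lessThan_iff member_le_sum)
  moreover have "(\<Sum>i<n + m. \<bar>?z $ i\<bar>) = (\<Sum>i<n + m. if i = k then 1 else 0)"
    by (intro sum.cong) auto
  ultimately show "(\<Sum>i<n + m. \<bar>?z $ i\<bar>) \<le> (\<Sum>i<n + m. \<bar>x $ i\<bar>)" using k by simp
qed simp

lemma difference_shortest:
  assumes "1 \<le> p" and ab: "a < s" "b < s" "a \<noteq> b"
    and eq: "\<And>i. s \<le> i \<Longrightarrow> i < n + m \<Longrightarrow> H $$ (i, a) = H $$ (i, b)"
    and no_unit: "\<And>k. k < s \<Longrightarrow> \<exists>i. s \<le> i \<and> i < n + m \<and> H $$ (i, k) \<noteq> 0"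
  shows "is_shortest_vector p H (vec (n + m) (\<lambda>i. if i = a then 1 else if i = b then - 1 else 0))"
    (is "is_shortest_vector p H ?z")
proof (rule is_shortestI[OF assms(1)])
  have n: "a < n" "b < n" using ab s_le by auto
  have "H $$ (i, a) - H $$ (i, b) = (if i = a then 1 else if i = b then - 1 else 0)" if "i < n + m" for i
    using that ab eq[of i] unit_row[OF _ n(1), of i] unit_row[OF _ n(2), of i] by (cases "i < s") auto
  then show "?z \<in> column_lattice H" using n by (intro column_diff_in_lattice[of a b]) auto
  show "\<exists>i<n + m. ?z $ i \<noteq> 0" using n by (intro exI[of _ a]) simp
  fix x assume x: "x \<in> column_lattice H" "\<exists>i<n + m. x $ i \<noteq> (0 :: int)"
  \<comment> \<open>A lattice vector with a single entry 1 or -1 would yield a column excluded by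
    \<open>no_unit\<close>.\<close>
  from x(2) have "2 \<le> (\<Sum>i<n + m. \<bar>x $ i\<bar>)"
  proof (cases rule: l1_norm_cases)
    case (2 k)
    from unit_vector_in_lattice[OF x(1) 2] no_unit[of k] show ?thesis by force
  qed
  moreover have "(\<Sum>i<n + m. \<bar>?z $ i\<bar>) = (\<Sum>i<n + m. (if i = a then 1 else 0) + (if i = b then 1 else 0))"
    using ab(3) by (intro sum.cong) auto
  ultimately show "(\<Sum>i<n + m. \<bar>?z $ i\<bar>) \<le> (\<Sum>i<n + m. \<bar>x $ i\<bar>)" using n by (simp add: sum.distrib)
qed simp

section \<open>From the matrix to the search\<close>

abbreviation cells :: "nat \<Rightarrow> int" where
  "cells \<equiv> snd (matrix_input n m H)"

lemma cells_eq:
  assumes "i < n + m" "j < n"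
  shows "cells (i * n + j) = H $$ (i, j)"
proof -
  have "Suc i * n \<le> (n + m) * n" using assms(1) by (intro mult_le_mono1) simp
  then have "i * n + j < (n + m) * n" using assms(2) by simp
  then show ?thesis using assms(2) unfolding matrix_input_def by simp
qed

lemma cells_last_row:
  assumes "j < n"
  shows "cells (n * n + j) = (if m = 0 then 0 else H $$ (n, j))"
  using cells_eq[of n j] assms by (auto simp: matrix_input_def)

lemma search_instance: "search_instance n m s cells (Delta H)"
proof
  show "m \<le> 1" by (rule at_most_one_extra_row)
  show "(\<Prod>i=s..<n. cells (i * n + i)) \<le> Delta H"
    using det_HB_le cells_eq unfolding det_HB by simp
  fix j assume "j < s"
  then show "\<bar>cells (n * n + j)\<bar> \<le> Delta H"
    using cells_last_row[of j] extra_row_bound[of n j] Delta_pos s_le by simp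
qed (use s_le cells_eq diag1 diag2 lower many_unit_rows in \<open>auto simp: matrix_input_def\<close>)

lemma svp_prog_solves:
  assumes "1 \<le> p"
  shows "\<exists>t \<tau> x. exec svp_prog (matrix_input n m H) t \<tau> \<and> outputs_vector (n + m) \<tau> x \<and>
    is_shortest_vector p H x \<and> real t \<le> 1164 * (real n * log 2 (real n) * (log_Delta H)\<^sup>2)"
proof -
  interpret search_instance n m s cells "Delta H" by (rule search_instance)
  obtain t R M where run: "exec svp_prog ((\<lambda>_. 0)(0 := int n, 1 := int m), cells) t (R, M)" "result R M"
    "t \<le> bits (int n) * bits (int n) + (26 + 5 * (n - s) + s * (8 * (n - s) + 19)) * unit_cost"
    by (rule svp_prog_correct)
  have input: "matrix_input n m H = ((\<lambda>_. 0)(0 := int n, 1 := int m), cells)"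
    by (simp add: matrix_input_def)
  define x where "x = vec (n + m) (\<lambda>i. M (out + i))"
  have outp: "outputs_vector (n + m) (R, M) x"
    using run(2) unfolding outputs_vector_def x_def result_def by auto
  \<comment> \<open>As \<open>m \<le> 1\<close>, the rows from \<open>s\<close> on are exactly those
    that enter \<open>col_code\<close>; for \<open>m = 0\<close> a padding zero replaces row
    \<open>n\<close>.\<close>
  have rows: "i < n \<or> i = n \<and> m = 1" if "i < n + m" for i using that m_le1 by auto
  have zero: "col_code k = int n \<longleftrightarrow> (\<forall>i. s \<le> i \<and> i < n + m \<longrightarrow> H $$ (i, k) = 0)" if "k < s" for k
    using that s_le cells_eq[of _ k] cells_last_row[of k] rows m_le1 unfolding col_code_zero_iff[OF that]
    by (cases "m = 0") (auto simp: less_Suc_eq)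
  have same: "H $$ (i, a) = H $$ (i, b)"
    if "a < s" "b < s" "col_code a = col_code b" "s \<le> i" "i < n + m" for a b i
  proof (cases "i < n")
    case True
    then show ?thesis
      using col_code_eqD(1)[OF that(1-3), of i] that s_le cells_eq[of i a] cells_eq[of i b] by simp
  next
    case False
    then show ?thesis
      using rows[OF that(5)] col_code_eqD(2)[OF that(1-3)] that s_le cells_last_row[of a]
        cells_last_row[of b] by simp
  qed
  have "is_shortest_vector p H x"
    using run(2) unfolding result_def
  proof (elim conjE disjE exE)
    fix k assume k: "k < s" "col_code k = int n" "\<forall>i<n + m. M (out + i) = (if i = k then 1 else 0)"
    then have "x = vec (n + m) (\<lambda>i. if i = k then 1 else 0)" unfolding x_def by (intro eq_vecI) auto
    then show ?thesis using unit_vector_shortest[OF assms k(1)] zero[OF k(1)] k(2) by simp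
  next
    fix a b assume ab: "\<forall>k<s. col_code k \<noteq> int n" "a < s" "b < s" "a \<noteq> b" "col_code a = col_code b"
      "\<forall>i<n + m. M (out + i) = (if i = a then 1 else if i = b then - 1 else 0)"
    then have "x = vec (n + m) (\<lambda>i. if i = a then 1 else if i = b then - 1 else 0)"
      unfolding x_def by (intro eq_vecI) auto
    then show ?thesis using difference_shortest[OF assms ab(2-4) same[OF ab(2,3,5)]] zero ab(1) by auto
  qed
  moreover have "real t \<le> 1164 * (real n * log 2 (real n) * (log_Delta H)\<^sup>2)"
    \<comment> \<open>\<open>log_Delta H\<close> is at least 1 and dominates \<open>n - s\<close>,
      as required of \<open>l\<close>.\<close>
    using bottom_size by (intro cost_bound[OF run(3)]) (auto simp: log_Delta_def)
  moreover have "exec svp_prog (matrix_input n m H) t (R, M)" by (subst input) (rule run(1))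
  ultimately show ?thesis using outp by blast
qed

end

theorem corollary2:
  shows "\<exists>C::real. \<forall>p::ereal. 1 \<le> p \<longrightarrow>
    (\<exists>prog::com. \<forall>(n::nat) (m::nat) (H::int mat).
       n \<ge> 1 \<longrightarrow>
       H \<in> carrier_mat (n + m) n \<longrightarrow>
       int_rank H = n \<longrightarrow>
       reduced_HNF n m H \<longrightarrow>
       no_singular_maximal_submatrix n H \<longrightarrow>
       real n > real_of_int (Delta H * (2 * Delta H + 1)\<^sup>2) + log 2 (real_of_int (Delta H)) \<longrightarrow>
       (\<exists>t \<tau> x. exec prog (matrix_input n m H) t \<tau> \<and>
          outputs_vector (n + m) \<tau> x \<and>
          is_shortest_vector p H x \<and>
          real t \<le> C * (real n * log 2 (real n) * (log_Delta H)\<^sup>2)))"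
\<comment> \<open>One program and one constant serve every \<open>p\<close>, because the comparison
  of norms goes through the l1 norm.\<close>
proof (intro exI[of _ "1164 :: real"] allI impI exI[of _ svp_prog])
  fix p :: ereal and n m :: nat and H :: "int mat"
  assume p: "1 \<le> p" and n: "n \<ge> 1" and *: "H \<in> carrier_mat (n + m) n" "int_rank H = n"
    and hnf: "reduced_HNF n m H" and **: "no_singular_maximal_submatrix n H"
    "real n > real_of_int (Delta H * (2 * Delta H + 1)\<^sup>2) + log 2 (real_of_int (Delta H))"
  obtain s where s: "s \<le> n" "\<forall>i<s. H $$ (i, i) = 1" "\<forall>i. s \<le> i \<and> i < n \<longrightarrow> H $$ (i, i) \<ge> 2"
    using hnf unfolding reduced_HNF_def by blast
  interpret hnf_instance n m s H
    by unfold_locales (use * ** s hnf in \<open>auto simp: reduced_HNF_def\<close>)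
  show "\<exists>t \<tau> x. exec svp_prog (matrix_input n m H) t \<tau> \<and> outputs_vector (n + m) \<tau> x \<and>
    is_shortest_vector p H x \<and> real t \<le> 1164 * (real n * log 2 (real n) * (log_Delta H)\<^sup>2)"
    by (rule svp_prog_solves[OF p])
qed

end
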